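(* Let $J$, $J'$ be matrices in standard form (see context) with $N=N'$ and $\operatorname{Prim}(m_N)=\operatorname{Prim}(m_N')$. Assume that the associated Perron-Frobenius eigenvalues $\lambda$, $\lambda'$ are rational (and thus integers), and let $m=\operatorname{lcm}(m_N,m_N')$. Assume there exist rational numbers $p$, $q$ (with $q\neq0$) such that $$m\text{-}\deg(J')\le\frac{p}{q}\qquad\text{and}\qquad\lambda'^{\,p}=\lambda^{q}.$$ Let $\alpha,\alpha'$, respectively $v,v'$, be the left, respectively right, Perron-Frobenius eigenvectors of $J$, $J'$ normalized to have first component $1$. If there exists a unital isomorphism $\mathfrak{A}_J\to\mathfrak{A}_{J'}$, then $$\frac{\langle\alpha\mid v\rangle}{\langle\alpha'\mid v'\rangle}\in\mathbb{Z}\left[\tfrac{1}{\lambda'}\right].$$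
   Context: Standard form: $N\ge1$, $m_1,\dots,m_N$ are nonnegative integers with $m_N>0$ and $\gcd\{i\mid m_i\ne0\}=1$, and $J$ is the $N\times N$ matrix with first column $(m_1,\dots,m_N)^t$, entries $1$ at positions $(i,i+1)$, $1\le i\le N-1$, and $0$ elsewhere. $\lambda$ is its Perron-Frobenius eigenvalue (unique positive root of $\lambda^N-m_1\lambda^{N-1}-\dots-m_N=0$), $\alpha=(1,\lambda^{-1},\dots,\lambda^{-(N-1)})$ satisfies $\alpha J=\lambda\alpha$, and $v$ is the column vector with $Jv=\lambda v$, $v_1=1$; $\langle\alpha\mid v\rangle=\sum_i\alpha_iv_i$. Primed symbols refer to $J'$. $G_J=\bigcup_{n\ge0}J^{-n}\mathbb{Z}^N\subset\mathbb{Q}^N$, ordered by: $g\neq0$ is positive iff $\langle\alpha\mid g\rangle>0$; $[1]=(1,0,\dots,0)^t$. $\mathfrak{A}_J$ is the unital AF-algebra (unique up to isomorphism) with $(K_0(\mathfrak{A}_J),K_0(\mathfrak{A}_J)_+,[1])\cong(G_J,(G_J)_+,[1])$. $\operatorname{Prim}(n)$ is the set of prime factors of $n$. If $m$ is a positive integer with exactly the same prime factors as $|\det J|=m_N$ and $t$ is a real number, "$m$-$\deg(J)\le t$" means that there is an $n_0\in\mathbb{N}$ such that for all $g\in G_J$ and all $i\in\mathbb{N}$: $m^ig\in\mathbb{Z}^N\Rightarrow g\in J^{-\lfloor it\rfloor-n_0}\mathbb{Z}^N$. *)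

theory Defs
  imports
    Complex_Main
    "HOL-Computational_Algebra.Primes"
    "HOL-Computational_Algebra.Polynomial"
    "HOL-Algebra.Group"
    "Jordan_Normal_Form.Matrix"
    "Jordan_Normal_Form.Gauss_Jordan_Elimination"
begin

section \<open>Matrices in standard form and their Perron-Frobenius data\<close>

text \<open>The parameters are \<open>m 1, \<dots>, m N\<close>; other values of \<open>m\<close> are irrelevant.
  Vectors and matrices of the matrix library are indexed from 0, so the entry \<open>m i\<close>
  sits in row \<open>i - 1\<close>.\<close>

definition standard_form :: "nat \<Rightarrow> (nat \<Rightarrow> nat) \<Rightarrow> bool" where
  "standard_form N m \<longleftrightarrow> 1 \<le> N \<and> 0 < m N \<and> Gcd {i \<in> {1..N}. m i \<noteq> 0} = 1"

definition std_mat :: "nat \<Rightarrow> (nat \<Rightarrow> nat) \<Rightarrow> 'a::semiring_1 mat" where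
  "std_mat N m = mat N N (\<lambda>(i, j). if j = 0 then of_nat (m (i + 1))
                                   else if j = i + 1 then 1 else 0)"

definition pf_eigenvalue :: "nat \<Rightarrow> (nat \<Rightarrow> nat) \<Rightarrow> real" where
  "pf_eigenvalue N m =
     (THE x. 0 < x \<and> x ^ N - (\<Sum>i = 1..N. real (m i) * x ^ (N - i)) = 0)"

definition pf_left :: "nat \<Rightarrow> (nat \<Rightarrow> nat) \<Rightarrow> real vec" where
  "pf_left N m = vec N (\<lambda>i. inverse (pf_eigenvalue N m) ^ i)"

definition pf_right :: "nat \<Rightarrow> (nat \<Rightarrow> nat) \<Rightarrow> real vec" where
  "pf_right N m = (THE v. v \<in> carrier_vec N \<and>
     std_mat N m *\<^sub>v v = pf_eigenvalue N m \<cdot>\<^sub>v v \<and> v $ 0 = 1)"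

text \<open>The descriptions above are proper: the positive root exists and is unique,
  \<open>pf_left\<close> is the normalized left eigenvector, and the normalized right eigenvector
  exists and is unique.\<close>

lemma pf_root_unique:
  assumes "standard_form N m"
  shows "\<exists>!x::real. 0 < x \<and> x ^ N - (\<Sum>i = 1..N. real (m i) * x ^ (N - i)) = 0"
proof -
  have N: "N \<ge> 1" and mN: "m N > 0"
    using assms by (auto simp: standard_form_def)
  define s where "s = (\<lambda>y::real. \<Sum>i = 1..N. real (m i) * y ^ i)"
  have eq: "(x ^ N - (\<Sum>i = 1..N. real (m i) * x ^ (N - i)) = 0) \<longleftrightarrow> s (inverse x) = 1"
    if "x > 0" for x :: real
  proof -
    have "(\<Sum>i = 1..N. real (m i) * x ^ (N - i)) = x ^ N * s (inverse x)"
      unfolding s_def sum_distrib_left using that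
      by (intro sum.cong) (auto simp: power_diff field_simps)
    then show ?thesis using that by auto
  qed
  have mono: "s y < s z" if "0 \<le> y" "y < z" for y z
    unfolding s_def
  proof (rule sum_strict_mono_ex1)
    show "\<forall>i\<in>{1..N}. real (m i) * y ^ i \<le> real (m i) * z ^ i"
      using that by (auto intro!: mult_left_mono power_mono)
    show "\<exists>i\<in>{1..N}. real (m i) * y ^ i < real (m i) * z ^ i"
      using that N mN by (intro bexI[of _ N]) (auto intro!: mult_strict_left_mono power_strict_mono)
  qed simp
  have s0: "s 0 = 0" unfolding s_def by (intro sum.neutral) auto
  have "real (m N) * 1 ^ N \<le> s 1" unfolding s_def
    using N by (intro member_le_sum[where f = "\<lambda>i. real (m i) * 1 ^ i"]) auto
  then have s1: "s 1 \<ge> 1" using mN by simp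
  have "continuous_on {0..1} s" unfolding s_def by (intro continuous_intros)
  then obtain y where y: "0 \<le> y" "y \<le> 1" "s y = 1"
    using IVT'[of s 0 1 1] s0 s1 by auto
  with s0 have y0: "y > 0" by (cases "y = 0") auto
  show ?thesis
  proof (rule ex1I[of _ "inverse y"])
    show "0 < inverse y \<and> inverse y ^ N - (\<Sum>i = 1..N. real (m i) * inverse y ^ (N - i)) = 0"
      using eq[of "inverse y"] y y0 by simp
  next
    fix x :: real
    assume x: "0 < x \<and> x ^ N - (\<Sum>i = 1..N. real (m i) * x ^ (N - i)) = 0"
    then have "s (inverse x) = s y" using eq[of x] y by simp
    moreover have "inverse x > 0" using x by simp
    ultimately have "inverse x = y" using mono[of "inverse x" y] mono[of y "inverse x"] y0
      by (cases "inverse x" y rule: linorder_cases) auto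
    then show "x = inverse y" by auto
  qed
qed

lemma pf_eigenvalue:
  assumes "standard_form N m"
  shows "0 < pf_eigenvalue N m"
    and "pf_eigenvalue N m ^ N = (\<Sum>i = 1..N. real (m i) * pf_eigenvalue N m ^ (N - i))"
  using theI'[OF pf_root_unique[OF assms]] unfolding pf_eigenvalue_def by auto

lemma pf_left_eigenvector:
  assumes "standard_form N m"
  shows "transpose_mat (std_mat N m) *\<^sub>v pf_left N m = pf_eigenvalue N m \<cdot>\<^sub>v pf_left N m"
    and "pf_left N m $ 0 = 1"
proof -
  let ?l = "pf_eigenvalue N m"
  have N: "N \<ge> 1" using assms by (auto simp: standard_form_def)
  note l = pf_eigenvalue[OF assms]
  show "pf_left N m $ 0 = 1" using N by (simp add: pf_left_def)
  show "transpose_mat (std_mat N m) *\<^sub>v pf_left N m = ?l \<cdot>\<^sub>v pf_left N m"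
  proof (rule eq_vecI)
    fix j assume "j < dim_vec (?l \<cdot>\<^sub>v pf_left N m)"
    then have j: "j < N" by (simp add: pf_left_def)
    have L: "(transpose_mat (std_mat N m) *\<^sub>v pf_left N m) $ j =
      (\<Sum>i = 0..<N. (if j = 0 then real (m (i + 1)) else if j = i + 1 then 1 else 0)
         * inverse ?l ^ i)"
      using j by (auto simp: std_mat_def pf_left_def scalar_prod_def intro!: sum.cong)
    show "(transpose_mat (std_mat N m) *\<^sub>v pf_left N m) $ j = (?l \<cdot>\<^sub>v pf_left N m) $ j"
    proof (cases "j = 0")
      case True
      have "?l ^ N * ?l = (\<Sum>i = 1..N. real (m i) * ?l ^ (N - i)) * ?l" using l by simp
      also have "\<dots> = (\<Sum>i = 1..N. ?l ^ N * (real (m i) * inverse ?l ^ (i - 1)))"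
        unfolding sum_distrib_right
      proof (intro sum.cong refl)
        fix i assume "i \<in> {1..N}"
        then obtain k where "i = Suc k" "k < N" by (cases i) auto
        then show "real (m i) * ?l ^ (N - i) * ?l = ?l ^ N * (real (m i) * inverse ?l ^ (i - 1))"
          using l(1) by (simp add: power_diff field_simps)
      qed
      also have "\<dots> = ?l ^ N * (\<Sum>i = 0..<N. real (m (i + 1)) * inverse ?l ^ i)"
        unfolding sum_distrib_left
        by (rule sum.reindex_bij_witness[of _ Suc "\<lambda>i. i - 1"]) auto
      finally have "?l = (\<Sum>i = 0..<N. real (m (i + 1)) * inverse ?l ^ i)"
        using l(1) by simp
      then show ?thesis unfolding L using True N by (simp add: pf_left_def)
    next
      case False
      then obtain k where k: "j = Suc k" by (cases j) auto
      have "(\<Sum>i = 0..<N. (if j = 0 then real (m (i + 1)) else if j = i + 1 then 1 else 0)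
         * inverse ?l ^ i) = (\<Sum>i = 0..<N. if i = k then inverse ?l ^ i else 0)"
        using k by (intro sum.cong) auto
      also have "\<dots> = inverse ?l ^ k" using k j by simp
      finally show ?thesis unfolding L using k j l(1) by (simp add: pf_left_def)
    qed
  qed (simp add: std_mat_def pf_left_def)
qed

lemma pf_right_unique:
  assumes "standard_form N m"
  shows "\<exists>!v. v \<in> carrier_vec N \<and>
     std_mat N m *\<^sub>v v = pf_eigenvalue N m \<cdot>\<^sub>v v \<and> v $ 0 = (1::real)"
proof -
  let ?l = "pf_eigenvalue N m"
  have N: "N \<ge> 1" using assms by (auto simp: standard_form_def)
  note l = pf_eigenvalue[OF assms]
  have row: "(std_mat N m *\<^sub>v v) $ i =
      real (m (i + 1)) * v $ 0 + (if i + 1 < N then v $ (i + 1) else 0)"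
    if v: "v \<in> carrier_vec N" and i: "i < N" for v :: "real vec" and i
  proof -
    have "(std_mat N m *\<^sub>v v) $ i =
      (\<Sum>j = 0..<N. (if j = 0 then real (m (i + 1)) else if j = i + 1 then 1 else 0) * v $ j)"
      using v i by (auto simp: std_mat_def scalar_prod_def intro!: sum.cong)
    also have "\<dots> = (\<Sum>j = 0..<N. (if j = 0 then real (m (i + 1)) * v $ j else 0) +
        (if j = i + 1 then v $ j else 0))"
      by (intro sum.cong) auto
    also have "\<dots> = real (m (i + 1)) * v $ 0 + (if i + 1 < N then v $ (i + 1) else 0)"
      unfolding sum.distrib using N by simp
    finally show ?thesis .
  qed
  define c where "c = (\<lambda>i. ?l ^ i - (\<Sum>k = 1..i. real (m k) * ?l ^ (i - k)))"
  have c_Suc: "c (Suc i) = ?l * c i - real (m (Suc i))" for i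
  proof -
    have "(\<Sum>k = 1..i. real (m k) * ?l ^ (Suc i - k)) = ?l * (\<Sum>k = 1..i. real (m k) * ?l ^ (i - k))"
      unfolding sum_distrib_left by (intro sum.cong) (auto simp: Suc_diff_le)
    then show ?thesis unfolding c_def by (simp add: algebra_simps)
  qed
  have c0: "c 0 = 1" and cN: "c N = 0" using l(2) by (auto simp: c_def)
  show ?thesis
  proof (rule ex1I[of _ "vec N c"])
    have "std_mat N m *\<^sub>v vec N c = ?l \<cdot>\<^sub>v vec N c"
    proof (rule eq_vecI)
      fix i assume "i < dim_vec (?l \<cdot>\<^sub>v vec N c)"
      then have i: "i < N" by simp
      have "(if i + 1 < N then vec N c $ (i + 1) else 0) = c (Suc i)"
        using i cN by (cases "Suc i = N") auto
      then show "(std_mat N m *\<^sub>v vec N c) $ i = (?l \<cdot>\<^sub>v vec N c) $ i"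
        using row[of "vec N c" i] i N c0 c_Suc[of i] by simp
    qed (simp add: std_mat_def)
    then show "vec N c \<in> carrier_vec N \<and> std_mat N m *\<^sub>v vec N c = ?l \<cdot>\<^sub>v vec N c \<and> vec N c $ 0 = 1"
      using N c0 by simp
  next
    fix v :: "real vec"
    assume v: "v \<in> carrier_vec N \<and> std_mat N m *\<^sub>v v = ?l \<cdot>\<^sub>v v \<and> v $ 0 = 1"
    have "i < N \<Longrightarrow> v $ i = c i" for i
    proof (induction i)
      case 0
      then show ?case using v c0 by simp
    next
      case (Suc i)
      have "?l * v $ i = real (m (i + 1)) * v $ 0 + v $ (i + 1)"
        using row[of v i] v Suc.prems by (auto simp: carrier_vecD)
      then show ?case using Suc v c_Suc[of i] by simp
    qed
    then show "v = vec N c" using v by (intro eq_vecI) auto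
  qed
qed


section \<open>Unital ordered groups with order unit, and the dimension group of \<open>J\<close>\<close>

record 'a unit_ordered_group = "'a monoid" +
  pos_cone :: "'a set"
  order_unit :: 'a

definition unit_ordered_iso ::
  "'a unit_ordered_group \<Rightarrow> 'b unit_ordered_group \<Rightarrow> bool" where
  "unit_ordered_iso G H \<longleftrightarrow> (\<exists>h \<in> iso G H.
     h ` pos_cone G = pos_cone H \<and> h (order_unit G) = order_unit H)"

definition mat_powi :: "'a::field mat \<Rightarrow> int \<Rightarrow> 'a mat" where
  "mat_powi A k = (if 0 \<le> k then A ^\<^sub>m nat k else the (mat_inverse A) ^\<^sub>m nat (- k))"

definition int_lattice :: "nat \<Rightarrow> rat vec set" where
  "int_lattice N = {g \<in> carrier_vec N. \<forall>i < N. g $ i \<in> \<int>}"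

definition dim_group_set :: "rat mat \<Rightarrow> rat vec set" where
  "dim_group_set J =
     (\<Union>n::nat. (\<lambda>z. mat_powi J (- int n) *\<^sub>v z) ` int_lattice (dim_row J))"

definition dim_group :: "nat \<Rightarrow> (nat \<Rightarrow> nat) \<Rightarrow> rat vec unit_ordered_group" where
  "dim_group N m = \<lparr>
     carrier = dim_group_set (std_mat N m),
     monoid.mult = (+),
     one = 0\<^sub>v N,
     pos_cone = {g \<in> dim_group_set (std_mat N m).
       g = 0\<^sub>v N \<or> 0 < scalar_prod (pf_left N m) (map_vec of_rat g)},
     order_unit = unit_vec N 0\<rparr>"

text \<open>\<open>m_deg_le k J t\<close> renders \<open>k\<close>-deg\<open>(J) \<le> t\<close>. It is only meaningful when \<open>k\<close> is positive
  and has the same prime factors as \<open>det J\<close>. The exponent of \<open>J\<close> is an integer of either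
  sign, since \<open>t\<close> may be negative.\<close>

definition m_deg_le :: "nat \<Rightarrow> rat mat \<Rightarrow> real \<Rightarrow> bool" where
  "m_deg_le k J t \<longleftrightarrow> (\<exists>n0::nat. \<forall>g \<in> dim_group_set J. \<forall>i::nat.
     of_nat k ^ i \<cdot>\<^sub>v g \<in> int_lattice (dim_row J) \<longrightarrow>
     g \<in> (\<lambda>z. mat_powi J (- \<lfloor>real i * t\<rfloor> - int n0) *\<^sub>v z) ` int_lattice (dim_row J))"

definition int_adjoin :: "real \<Rightarrow> real set" where
  "int_adjoin x = range (\<lambda>f::int poly. poly (map_poly of_int f) x)"


section \<open>Unital C*-algebras and AF-algebras\<close>

class unital_cstar_algebra = real_normed_algebra_1 + banach +
  fixes scaleC :: "complex \<Rightarrow> 'a \<Rightarrow> 'a"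
    and star :: "'a \<Rightarrow> 'a"
  assumes scaleC_of_real: "scaleC (of_real r) x = scaleR r x"
    and scaleC_add_right: "scaleC a (x + y) = scaleC a x + scaleC a y"
    and scaleC_add_left: "scaleC (a + b) x = scaleC a x + scaleC b x"
    and scaleC_scaleC: "scaleC a (scaleC b x) = scaleC (a * b) x"
    and norm_scaleC: "norm (scaleC a x) = cmod a * norm x"
    and mult_scaleC_left: "scaleC a x * y = scaleC a (x * y)"
    and mult_scaleC_right: "x * scaleC a y = scaleC a (x * y)"
    and star_add: "star (x + y) = star x + star y"
    and star_scaleC: "star (scaleC a x) = scaleC (cnj a) (star x)"
    and star_mult: "star (x * y) = star y * star x"
    and star_star: "star (star x) = x"
    and norm_star_mult_self: "norm (star x * x) = norm x ^ 2"

definition unital_star_isomorphism ::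
  "('a::unital_cstar_algebra \<Rightarrow> 'b::unital_cstar_algebra) \<Rightarrow> bool" where
  "unital_star_isomorphism \<phi> \<longleftrightarrow> bij \<phi> \<and>
     (\<forall>x y. \<phi> (x + y) = \<phi> x + \<phi> y) \<and>
     (\<forall>a x. \<phi> (scaleC a x) = scaleC a (\<phi> x)) \<and>
     (\<forall>x y. \<phi> (x * y) = \<phi> x * \<phi> y) \<and>
     (\<forall>x. \<phi> (star x) = star (\<phi> x)) \<and>
     \<phi> 1 = 1"

definition fd_star_subalgebra :: "'a::unital_cstar_algebra set \<Rightarrow> bool" where
  "fd_star_subalgebra B \<longleftrightarrow> 0 \<in> B \<and>
     (\<forall>x\<in>B. \<forall>y\<in>B. x + y \<in> B \<and> x * y \<in> B) \<and>
     (\<forall>x\<in>B. \<forall>a. scaleC a x \<in> B) \<and>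
     (\<forall>x\<in>B. star x \<in> B) \<and>
     (\<exists>S. finite S \<and> (\<forall>x\<in>B. \<exists>c. x = (\<Sum>s\<in>S. scaleC (c s) s)))"

definition AF_algebra :: "'a::unital_cstar_algebra itself \<Rightarrow> bool" where
  "AF_algebra _ \<longleftrightarrow> (\<exists>B :: nat \<Rightarrow> 'a set. incseq B \<and> (\<forall>n. fd_star_subalgebra (B n)) \<and>
     (\<forall>x. \<forall>e > 0. \<exists>y \<in> \<Union>n. B n. dist x y < e))"


section \<open>The ordered group \<open>K\<^sub>0\<close> of a unital C*-algebra\<close>

definition mat_star :: "'a::unital_cstar_algebra mat \<Rightarrow> 'a mat" where
  "mat_star A = mat (dim_col A) (dim_row A) (\<lambda>(i, j). star (A $$ (j, i)))"

definition mat_projections :: "'a::unital_cstar_algebra mat set" where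
  "mat_projections = {p. square_mat p \<and> p * p = p \<and> mat_star p = p}"

text \<open>Murray-von Neumann equivalence of projections, possibly of different sizes.\<close>

definition mvn_equiv :: "'a::unital_cstar_algebra mat \<Rightarrow> 'a mat \<Rightarrow> bool" where
  "mvn_equiv p q \<longleftrightarrow> (\<exists>v \<in> carrier_mat (dim_row q) (dim_row p).
     mat_star v * v = p \<and> v * mat_star v = q)"

definition mat_dsum :: "'a::zero mat \<Rightarrow> 'a mat \<Rightarrow> 'a mat" where
  "mat_dsum p q = four_block_mat p (0\<^sub>m (dim_row p) (dim_col q)) (0\<^sub>m (dim_row q) (dim_col p)) q"

text \<open>\<open>K\<^sub>0\<close> is the Grothendieck group of the semigroup of Murray-von Neumann classes:
  a pair \<open>(p, q)\<close> stands for the formal difference \<open>[p] - [q]\<close>. The empty matrix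
  represents the class \<open>0\<close>, and the positive cone consists of the classes \<open>[p] - 0\<close>.\<close>

definition K0_rel :: "(('a::unital_cstar_algebra mat \<times> 'a mat) \<times> ('a mat \<times> 'a mat)) set" where
  "K0_rel = {((p, q), (p', q')).
     p \<in> mat_projections \<and> q \<in> mat_projections \<and> p' \<in> mat_projections \<and> q' \<in> mat_projections \<and>
     (\<exists>r \<in> mat_projections.
        mvn_equiv (mat_dsum (mat_dsum p q') r) (mat_dsum (mat_dsum p' q) r))}"

definition K0_class :: "'a::unital_cstar_algebra mat \<Rightarrow> 'a mat \<Rightarrow> ('a mat \<times> 'a mat) set" where
  "K0_class p q = K0_rel `` {(p, q)}"

definition K0 :: "'a::unital_cstar_algebra itself \<Rightarrow> ('a mat \<times> 'a mat) set unit_ordered_group" where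
  "K0 _ = \<lparr>
     carrier = (mat_projections \<times> mat_projections) // K0_rel,
     monoid.mult = (\<lambda>X Y. \<Union>(p, q)\<in>X. \<Union>(p', q')\<in>Y. K0_class (mat_dsum p p') (mat_dsum q q')),
     one = K0_class (0\<^sub>m 0 0) (0\<^sub>m 0 0),
     pos_cone = (\<lambda>p. K0_class p (0\<^sub>m 0 0)) ` mat_projections,
     order_unit = K0_class (1\<^sub>m 1) (0\<^sub>m 0 0)\<rparr>"

text \<open>The algebra \<open>\<AA>\<^sub>J\<close> is determined up to isomorphism by its ordered \<open>K\<^sub>0\<close>-group with
  order unit; \<open>is_AF_of TYPE('a) N m\<close> says that \<open>'a\<close> is (a copy of) that algebra.\<close>

definition is_AF_of :: "'a::unital_cstar_algebra itself \<Rightarrow> nat \<Rightarrow> (nat \<Rightarrow> nat) \<Rightarrow> bool" where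
  "is_AF_of A N m \<longleftrightarrow> AF_algebra A \<and> unit_ordered_iso (K0 A) (dim_group N m)"

end

theory Submission
  imports Defs "Jordan_Normal_Form.Determinant"
begin

text \<open>A unital isomorphism of the algebras induces an isomorphism \<open>h : G\<^sub>J \<rightarrow> G\<^sub>J\<^sub>'\<close> of ordered groups
  with unit, and \<open>h\<close> transports \<open>\<langle>\<alpha> | \<cdot>\<rangle>\<close> to \<open>\<langle>\<alpha>' | \<cdot>\<rangle>\<close>. The integral eigenvector \<open>v\<close> is divisible by
  all powers of \<open>\<lambda>\<close> in \<open>G\<^sub>J\<close>, hence so is \<open>h v\<close> in \<open>G\<^sub>J\<^sub>'\<close>. Write \<open>p / q = a / b\<close>, so that
  \<open>\<lambda>'\<^sup>a = \<lambda>\<^sup>b\<close>. Since \<open>\<lambda>\<close> divides \<open>m\<close>, the degree condition applied to \<open>\<lambda>\<^sup>-\<^sup>b\<^sup>n h v\<close> yields a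
  constant \<open>c\<close> such that \<open>w = J'\<^sup>c h v\<close> satisfies \<open>(J'\<^sup>a / \<lambda>'\<^sup>a)\<^sup>n w \<in> \<int>\<^sup>N\<close> for all \<open>n\<close>. Since \<open>J'\<close> is
  primitive, this integral sequence becomes constant, equal to \<open>M v'\<close> for an integer \<open>M\<close>.
  Pairing with \<open>\<alpha>'\<close> gives \<open>\<lambda>'\<^sup>c \<langle>\<alpha> | v\<rangle> = M \<langle>\<alpha>' | v'\<rangle>\<close>.\<close>

section \<open>Functoriality of the ordered group \<open>K\<^sub>0\<close>\<close>

lemma star_zero [simp]: "star (0::'a::unital_cstar_algebra) = 0"
proof -
  have "star (0::'a) + star 0 = star 0 + 0" by (simp flip: star_add)
  then show ?thesis by (simp only: add_left_cancel)
qed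

lemma star_one [simp]: "star (1::'a::unital_cstar_algebra) = 1"
proof -
  have "(1::'a) = star (star 1 * 1)" by (simp only: star_star mult_1_right)
  also have "\<dots> = star 1 * star (star 1)" by (rule star_mult)
  also have "\<dots> = star 1" by (simp only: star_star mult_1_right)
  finally show ?thesis ..
qed

lemma star_sum: "star (sum f S) = (\<Sum>i\<in>S. star (f i :: 'a::unital_cstar_algebra))"
  by (induction S rule: infinite_finite_induct) (auto simp: star_add)

lemma dim_mat_star [simp]: "dim_row (mat_star A) = dim_col A" "dim_col (mat_star A) = dim_row A"
  by (simp_all add: mat_star_def)

lemma mat_star_carrier [simp]: "A \<in> carrier_mat a b \<Longrightarrow> mat_star A \<in> carrier_mat b a"
  by (intro carrier_matI) auto

lemma mat_star_star [simp]: "mat_star (mat_star A) = A"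
  by (rule eq_matI) (auto simp: mat_star_def star_star)

lemma mat_star_zero [simp]: "mat_star (0\<^sub>m a b) = 0\<^sub>m b a"
  by (rule eq_matI) (auto simp: mat_star_def)

lemma mat_star_one [simp]: "mat_star (1\<^sub>m n) = 1\<^sub>m n"
  by (rule eq_matI) (auto simp: mat_star_def)

lemma mat_star_mult:
  assumes "A \<in> carrier_mat a b" "B \<in> carrier_mat b c"
  shows "mat_star (A * B) = mat_star B * mat_star A"
  using assms by (intro eq_matI)
    (auto simp: mat_star_def scalar_prod_def star_sum star_mult intro!: sum.cong)

lemma mat_star_four_block:
  assumes "A \<in> carrier_mat a b" "B \<in> carrier_mat a c" "C \<in> carrier_mat d b" "D \<in> carrier_mat d c"
  shows "mat_star (four_block_mat A B C D) =
    four_block_mat (mat_star A) (mat_star C) (mat_star B) (mat_star D)"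
  using assms by (intro eq_matI) (auto simp: mat_star_def)

lemma dim_mat_dsum [simp]:
  "dim_row (mat_dsum A B) = dim_row A + dim_row B" "dim_col (mat_dsum A B) = dim_col A + dim_col B"
  by (simp_all add: mat_dsum_def)

lemma mat_dsum_carrier:
  "A \<in> carrier_mat a b \<Longrightarrow> B \<in> carrier_mat c d \<Longrightarrow> mat_dsum A B \<in> carrier_mat (a + c) (b + d)"
  by (intro carrier_matI) auto

lemma mat_dsum_mult:
  fixes A :: "'a::semiring_0 mat"
  assumes "A \<in> carrier_mat a b" "A' \<in> carrier_mat b c" "B \<in> carrier_mat d e" "B' \<in> carrier_mat e f"
  shows "mat_dsum A B * mat_dsum A' B' = mat_dsum (A * A') (B * B')"
proof -
  have d: "dim_row A = a" "dim_col A = b" "dim_row A' = b" "dim_col A' = c"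
    "dim_row B = d" "dim_col B = e" "dim_row B' = e" "dim_col B' = f"
    using assms by auto
  show ?thesis
    unfolding mat_dsum_def d index_mult_mat
    by (subst mult_four_block_mat[of _ a b _ e _ d _ _ c _ f]) (use assms in auto)
qed

lemma mat_star_dsum: "mat_star (mat_dsum A B) = mat_dsum (mat_star A) (mat_star B)"
  unfolding mat_dsum_def
  by (subst mat_star_four_block[of _ "dim_row A" "dim_col A" _ "dim_col B" _ "dim_row B"]) auto

lemma mat_dsum_assoc: "mat_dsum (mat_dsum A B) C = mat_dsum A (mat_dsum B C)"
  unfolding mat_dsum_def by (rule assoc_four_block_mat[symmetric])

lemma mat_dsum_empty [simp]: "mat_dsum A (0\<^sub>m 0 0) = A"
  by (rule eq_matI) (auto simp: mat_dsum_def)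

lemma mat_projectionsD:
  assumes "p \<in> mat_projections"
  shows "p \<in> carrier_mat (dim_row p) (dim_row p)" "p * p = p" "mat_star p = p"
  using assms by (auto simp: mat_projections_def)

lemma mat_projectionsI:
  "p \<in> carrier_mat n n \<Longrightarrow> p * p = p \<Longrightarrow> mat_star p = p \<Longrightarrow> p \<in> mat_projections"
  by (auto simp: mat_projections_def)

lemma zero_mat_projections [simp]: "0\<^sub>m n n \<in> mat_projections"
  by (rule mat_projectionsI) auto

lemma one_mat_projections [simp]: "1\<^sub>m n \<in> mat_projections"
  by (rule mat_projectionsI) auto

lemma mat_dsum_projections:
  assumes "p \<in> mat_projections" "q \<in> mat_projections"
  shows "mat_dsum p q \<in> mat_projections"
proof (rule mat_projectionsI)
  note p = mat_projectionsD[OF assms(1)] and q = mat_projectionsD[OF assms(2)]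
  show "mat_dsum p q \<in> carrier_mat (dim_row p + dim_row q) (dim_row p + dim_row q)"
    by (rule mat_dsum_carrier[OF p(1) q(1)])
  show "mat_dsum p q * mat_dsum p q = mat_dsum p q"
    by (simp only: mat_dsum_mult[OF p(1) p(1) q(1) q(1)] p(2) q(2))
  show "mat_star (mat_dsum p q) = mat_dsum p q"
    by (simp only: mat_star_dsum p(3) q(3))
qed

section \<open>Murray-von Neumann equivalence and the commutative monoid of its classes\<close>

lemma mvn_equivI:
  "v \<in> carrier_mat (dim_row q) (dim_row p) \<Longrightarrow> mat_star v * v = p \<Longrightarrow> v * mat_star v = q \<Longrightarrow> mvn_equiv p q"
  unfolding mvn_equiv_def by blast

lemma mvn_equiv_refl: "p \<in> mat_projections \<Longrightarrow> mvn_equiv p p"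
  by (rule mvn_equivI[of p]) (auto simp: mat_projectionsD)

lemma mvn_equiv_sym:
  assumes "mvn_equiv p q" shows "mvn_equiv q p"
proof -
  obtain v where "v \<in> carrier_mat (dim_row q) (dim_row p)" "mat_star v * v = p" "v * mat_star v = q"
    using assms by (auto simp: mvn_equiv_def)
  then show ?thesis by (intro mvn_equivI[of "mat_star v"]) auto
qed

text \<open>The partial isometries compose: for \<open>w * v\<close> one product collapses to
  \<open>mat_star v * q * v\<close>, which is \<open>p * p\<close> because
  \<open>q = v * mat_star v\<close>; idempotence of \<open>p\<close> finishes. The other product
  reduces to \<open>r * r\<close> in the same way.\<close>

lemma mvn_equiv_trans:
  fixes p q r :: "'a::unital_cstar_algebra mat"
  assumes "p \<in> mat_projections" "r \<in> mat_projections" "mvn_equiv p q" "mvn_equiv q r"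
  shows "mvn_equiv p r"
proof -
  let ?p = "dim_row p" and ?q = "dim_row q" and ?r = "dim_row r"
  obtain v where v: "v \<in> carrier_mat ?q ?p" "mat_star v * v = p" "v * mat_star v = q"
    using assms(3) by (auto simp: mvn_equiv_def)
  obtain w where w: "w \<in> carrier_mat ?r ?q" "mat_star w * w = q" "w * mat_star w = r"
    using assms(4) by (auto simp: mvn_equiv_def)
  have v': "mat_star v \<in> carrier_mat ?p ?q" and w': "mat_star w \<in> carrier_mat ?q ?r"
    using v w by auto
  have "mat_star (w * v) * (w * v) = mat_star v * (mat_star w * w * v)"
    by (simp add: mat_star_mult[OF w(1) v(1)] assoc_mult_mat[OF v' w' mult_carrier_mat[OF w(1) v(1)]]
        assoc_mult_mat[OF w' w(1) v(1)])
  also have "\<dots> = mat_star v * (v * mat_star v * v)" by (simp only: w v)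
  also have "\<dots> = (mat_star v * v) * (mat_star v * v)"
    by (simp only: assoc_mult_mat[OF v(1) v' v(1)] assoc_mult_mat[OF v' v(1) mult_carrier_mat[OF v' v(1)]])
  also have "\<dots> = p" by (simp only: v mat_projectionsD[OF assms(1)])
  finally have 1: "mat_star (w * v) * (w * v) = p" .
  have "(w * v) * mat_star (w * v) = w * (v * mat_star v * mat_star w)"
    by (simp add: mat_star_mult[OF w(1) v(1)] assoc_mult_mat[OF w(1) v(1) mult_carrier_mat[OF v' w']]
        assoc_mult_mat[OF v(1) v' w'])
  also have "\<dots> = w * (mat_star w * w * mat_star w)" by (simp only: w v)
  also have "\<dots> = (w * mat_star w) * (w * mat_star w)"
    by (simp only: assoc_mult_mat[OF w' w(1) w'] assoc_mult_mat[OF w(1) w' mult_carrier_mat[OF w(1) w']])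
  also have "\<dots> = r" by (simp only: w mat_projectionsD[OF assms(2)])
  finally show ?thesis using 1 v w by (intro mvn_equivI[of "w * v"]) auto
qed

lemma mvn_equiv_dsum:
  assumes "mvn_equiv p q" "mvn_equiv p' q'"
  shows "mvn_equiv (mat_dsum p p') (mat_dsum q q')"
proof -
  obtain v where v: "v \<in> carrier_mat (dim_row q) (dim_row p)" "mat_star v * v = p" "v * mat_star v = q"
    using assms(1) by (auto simp: mvn_equiv_def)
  obtain w where w: "w \<in> carrier_mat (dim_row q') (dim_row p')" "mat_star w * w = p'" "w * mat_star w = q'"
    using assms(2) by (auto simp: mvn_equiv_def)
  note c = mat_star_carrier[OF v(1)] mat_star_carrier[OF w(1)]
  show ?thesis
  proof (rule mvn_equivI[of "mat_dsum v w"])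
    show "mat_dsum v w \<in> carrier_mat (dim_row (mat_dsum q q')) (dim_row (mat_dsum p p'))"
      using mat_dsum_carrier[OF v(1) w(1)] by simp
    show "mat_star (mat_dsum v w) * mat_dsum v w = mat_dsum p p'"
      unfolding mat_star_dsum mat_dsum_mult[OF c(1) v(1) c(2) w(1)] v w ..
    show "mat_dsum v w * mat_star (mat_dsum v w) = mat_dsum q q'"
      unfolding mat_star_dsum mat_dsum_mult[OF v(1) c(1) w(1) c(2)] v w ..
  qed
qed

text \<open>The witness is the off-diagonal block matrix that exchanges the two summands, with
  \<open>q\<close> and \<open>p\<close> in place of identity blocks so that its products are exactly
  the two direct sums.\<close>

lemma mvn_equiv_dsum_commute:
  assumes "p \<in> mat_projections" "q \<in> mat_projections"
  shows "mvn_equiv (mat_dsum p q) (mat_dsum q p)"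
proof -
  obtain a b where p: "p \<in> carrier_mat a a" and q: "q \<in> carrier_mat b b"
    using mat_projectionsD(1) assms by blast
  note pp = mat_projectionsD(2,3)[OF assms(1)] and qq = mat_projectionsD(2,3)[OF assms(2)]
  let ?v = "four_block_mat (0\<^sub>m b a) q p (0\<^sub>m a b)"
    and ?w = "four_block_mat (0\<^sub>m a b) p q (0\<^sub>m b a)"
  have star: "mat_star ?v = ?w"
    unfolding mat_star_four_block[OF zero_carrier_mat q p zero_carrier_mat]
    by (simp only: mat_star_zero pp qq)
  have d: "dim_row p = a" "dim_col p = a" "dim_row q = b" "dim_col q = b" using p q by auto
  note mult = mult_four_block_mat[OF zero_carrier_mat _ _ zero_carrier_mat zero_carrier_mat _ _ zero_carrier_mat]
  show ?thesis
  proof (rule mvn_equivI[of ?v])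
    show "?v \<in> carrier_mat (dim_row (mat_dsum q p)) (dim_row (mat_dsum p q))"
      by (intro carrier_matI) (simp_all add: d)
    have "?w * ?v = four_block_mat p (0\<^sub>m a b) (0\<^sub>m b a) q"
      unfolding mult[OF p q q p] pp qq using p q by (intro cong_four_block_mat) simp_all
    then show "mat_star ?v * ?v = mat_dsum p q" by (simp only: star mat_dsum_def d)
    have "?v * ?w = four_block_mat q (0\<^sub>m b a) (0\<^sub>m a b) p"
      unfolding mult[OF q p p q] pp qq using p q by (intro cong_four_block_mat) simp_all
    then show "?v * mat_star ?v = mat_dsum q p" by (simp only: star mat_dsum_def d)
  qed
qed

text \<open>On Murray-von Neumann classes the direct sum is a commutative monoid operation, so the
  algebra behind \<^const>\<open>K0_rel\<close> can be left to rewriting modulo associativity and commutativity.\<close>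

quotient_type (overloaded) 'a mvn_class = "'a::unital_cstar_algebra mat" /
  partial: "\<lambda>p q. p \<in> mat_projections \<and> q \<in> mat_projections \<and> mvn_equiv p q"
proof (rule part_equivpI)
  show "\<exists>x::'a mat. x \<in> mat_projections \<and> x \<in> mat_projections \<and> mvn_equiv x x"
    using mvn_equiv_refl[OF zero_mat_projections[of 0]] zero_mat_projections by blast
  show "symp (\<lambda>p q::'a mat. p \<in> mat_projections \<and> q \<in> mat_projections \<and> mvn_equiv p q)"
    by (auto intro!: sympI mvn_equiv_sym)
  show "transp (\<lambda>p q::'a mat. p \<in> mat_projections \<and> q \<in> mat_projections \<and> mvn_equiv p q)"
    by (auto intro!: transpI intro: mvn_equiv_trans)
qed

instantiation mvn_class :: (unital_cstar_algebra) comm_monoid_add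
begin

lift_definition zero_mvn_class :: "'a mvn_class" is "0\<^sub>m 0 0"
  by (simp add: mvn_equiv_refl)

lift_definition plus_mvn_class :: "'a mvn_class \<Rightarrow> 'a mvn_class \<Rightarrow> 'a mvn_class" is mat_dsum
  by (auto intro: mat_dsum_projections mvn_equiv_dsum)

instance
proof
  fix a b c :: "'a mvn_class"
  show "a + b + c = a + (b + c)"
    by transfer (auto simp: mat_dsum_assoc intro!: mat_dsum_projections mvn_equiv_refl)
  show "a + b = b + a"
    by transfer (auto intro!: mat_dsum_projections mvn_equiv_dsum_commute)
  have "b + 0 = b" by transfer simp
  \<comment> \<open>The rule \<open>mat_dsum_empty\<close> is disabled so that the empty summand on
    the right survives and commutativity of the direct sum matches.\<close>
  moreover have "0 + b = b + 0"
    by transfer (auto intro!: mat_dsum_projections mvn_equiv_dsum_commute simp del: mat_dsum_empty)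
  ultimately show "0 + b = b" by simp
qed

end

lemma abs_mvn_class_eq_iff:
  "p \<in> mat_projections \<Longrightarrow> q \<in> mat_projections \<Longrightarrow>
    abs_mvn_class p = abs_mvn_class q \<longleftrightarrow> mvn_equiv p q"
  using Quotient3_rel[OF Quotient3_mvn_class, of p q] by (auto simp: mvn_equiv_refl)

lemma abs_mvn_class_dsum:
  "p \<in> mat_projections \<Longrightarrow> q \<in> mat_projections \<Longrightarrow>
    abs_mvn_class (mat_dsum p q) = abs_mvn_class p + abs_mvn_class q"
  by (simp add: plus_mvn_class.abs_eq mvn_equiv_refl)

text \<open>Every class has a projection as representative, so the stabilising summand may range
  over classes. The relation becomes the Grothendieck relation of a commutative monoid.\<close>

lemma K0_rel_iff:
  "((p, q), (p', q')) \<in> K0_rel \<longleftrightarrow>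
     p \<in> mat_projections \<and> q \<in> mat_projections \<and> p' \<in> mat_projections \<and> q' \<in> mat_projections \<and>
     (\<exists>r. abs_mvn_class p + abs_mvn_class q' + r = abs_mvn_class p' + abs_mvn_class q + r)"
  (is "?L \<longleftrightarrow> ?P \<and> ?P1 \<and> ?P2 \<and> ?P3 \<and> ?R")
proof (cases "?P \<and> ?P1 \<and> ?P2 \<and> ?P3")
  case True
  have "?R \<longleftrightarrow> (\<exists>r\<in>mat_projections. abs_mvn_class p + abs_mvn_class q' + abs_mvn_class r =
      abs_mvn_class p' + abs_mvn_class q + abs_mvn_class r)"
  proof
    assume ?R
    then obtain r where "abs_mvn_class p + abs_mvn_class q' + r = abs_mvn_class p' + abs_mvn_class q + r"
      by blast
    moreover obtain r0 where "r = abs_mvn_class r0" "r0 \<in> mat_projections"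
      using Quotient3_abs_rep[OF Quotient3_mvn_class, of r] Quotient3_rep_reflp[OF Quotient3_mvn_class, of r]
      by metis
    ultimately show "\<exists>r\<in>mat_projections. abs_mvn_class p + abs_mvn_class q' + abs_mvn_class r =
      abs_mvn_class p' + abs_mvn_class q + abs_mvn_class r" by blast
  qed blast
  also have "\<dots> \<longleftrightarrow> (\<exists>r\<in>mat_projections.
      mvn_equiv (mat_dsum (mat_dsum p q') r) (mat_dsum (mat_dsum p' q) r))"
    using True by (intro bex_cong refl)
      (simp add: mat_dsum_projections flip: abs_mvn_class_dsum abs_mvn_class_eq_iff)
  finally show ?thesis using True by (simp add: K0_rel_def)
qed (auto simp: K0_rel_def)

lemma equiv_K0_rel:
  "equiv (mat_projections \<times> mat_projections)
    (K0_rel :: (('a::unital_cstar_algebra mat \<times> 'a mat) \<times> ('a mat \<times> 'a mat)) set)" (is "equiv ?P ?R")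
proof (rule equivI)
  show "?R \<subseteq> ?P \<times> ?P"
    by (auto simp: K0_rel_iff)
  show "refl_on ?P ?R"
    by (auto simp: refl_on_def K0_rel_iff)
  show "sym ?R"
  proof (rule symI)
    fix x y :: "'a mat \<times> 'a mat" assume "(x, y) \<in> K0_rel"
    then show "(y, x) \<in> K0_rel" by (cases x; cases y) (auto simp: K0_rel_iff intro: sym)
  qed
  show "trans ?R"
  proof (rule transI)
    fix x y z :: "'a mat \<times> 'a mat" assume xyz: "(x, y) \<in> K0_rel" "(y, z) \<in> K0_rel"
    obtain p q p' q' p'' q'' where eq: "x = (p, q)" "y = (p', q')" "z = (p'', q'')"
      by (cases x; cases y; cases z)
    have 1: "((p, q), (p', q')) \<in> K0_rel" and 2: "((p', q'), (p'', q'')) \<in> K0_rel"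
      using xyz by (simp_all add: eq)
    let ?c = abs_mvn_class
    obtain r where r: "?c p + ?c q' + r = ?c p' + ?c q + r" using 1 by (auto simp: K0_rel_iff)
    obtain s where s: "?c p' + ?c q'' + s = ?c p'' + ?c q' + s" using 2 by (auto simp: K0_rel_iff)
    \<comment> \<open>The monoid need not be cancellative: the two equations are added, and the
      middle pair \<open>p'\<close>, \<open>q'\<close> is moved into the stabilising
      summand.\<close>
    have "?c p + ?c q'' + (?c q' + r + ?c p' + s) = (?c p + ?c q' + r) + (?c p' + ?c q'' + s)"
      by (simp add: ac_simps)
    also have "\<dots> = (?c p' + ?c q + r) + (?c p'' + ?c q' + s)" by (simp only: r s)
    also have "\<dots> = ?c p'' + ?c q + (?c q' + r + ?c p' + s)" by (simp add: ac_simps)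
    finally show "(x, z) \<in> K0_rel" using 1 2 unfolding eq K0_rel_iff by blast
  qed
qed

lemma K0_rel_dsum:
  assumes 1: "((p, q), (p', q')) \<in> K0_rel" and 2: "((s, t), (s', t')) \<in> K0_rel"
  shows "((mat_dsum p s, mat_dsum q t), (mat_dsum p' s', mat_dsum q' t')) \<in> K0_rel"
proof -
  let ?c = abs_mvn_class
  obtain r where r: "?c p + ?c q' + r = ?c p' + ?c q + r" using 1 by (auto simp: K0_rel_iff)
  obtain u where u: "?c s + ?c t' + u = ?c s' + ?c t + u" using 2 by (auto simp: K0_rel_iff)
  have "(?c p + ?c s) + (?c q' + ?c t') + (r + u) = (?c p + ?c q' + r) + (?c s + ?c t' + u)"
    by (simp add: ac_simps)
  also have "\<dots> = (?c p' + ?c q + r) + (?c s' + ?c t + u)" by (simp only: r u)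
  also have "\<dots> = (?c p' + ?c s') + (?c q + ?c t) + (r + u)" by (simp add: ac_simps)
  finally show ?thesis
    using 1 2 by (auto simp: K0_rel_iff mat_dsum_projections abs_mvn_class_dsum)
qed

section \<open>Arithmetic of \<open>K0\<close> on classes of formal differences\<close>

lemma K0_select:
  "carrier (K0 T) = (mat_projections \<times> mat_projections) // K0_rel"
  "X \<otimes>\<^bsub>K0 T\<^esub> Y = (\<Union>(p, q)\<in>X. \<Union>(p', q')\<in>Y. K0_class (mat_dsum p p') (mat_dsum q q'))"
  "pos_cone (K0 T) = (\<lambda>p. K0_class p (0\<^sub>m 0 0)) ` mat_projections"
  "order_unit (K0 T) = K0_class (1\<^sub>m 1) (0\<^sub>m 0 0)"
  by (simp_all only: K0_def partial_object.simps monoid.simps unit_ordered_group.simps)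

text \<open>The product is a union over all representatives. By \<open>K0_rel_dsum\<close> all sets
  in this union coincide, and since the classes are nonempty the union collapses to that common
  class.\<close>

lemma K0_mult_class:
  assumes "p \<in> mat_projections" "q \<in> mat_projections" "p' \<in> mat_projections" "q' \<in> mat_projections"
  shows "K0_class p q \<otimes>\<^bsub>K0 T\<^esub> K0_class p' q' = K0_class (mat_dsum p p') (mat_dsum q q')"
proof -
  have 1: "(p, q) \<in> K0_class p q" "(p', q') \<in> K0_class p' q'"
    using assms by (auto simp: K0_class_def K0_rel_iff)
  have 2: "K0_class (mat_dsum a a') (mat_dsum b b') = K0_class (mat_dsum p p') (mat_dsum q q')"
    if "(a, b) \<in> K0_class p q" "(a', b') \<in> K0_class p' q'" for a b a' b'
  proof -
    have "((mat_dsum p p', mat_dsum q q'), (mat_dsum a a', mat_dsum b b')) \<in> K0_rel"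
      using that by (intro K0_rel_dsum) (auto simp: K0_class_def)
    then show ?thesis unfolding K0_class_def by (rule equiv_class_eq[OF equiv_K0_rel, symmetric])
  qed
  have 3: "(\<Union>(a', b')\<in>K0_class p' q'. K0_class (mat_dsum a a') (mat_dsum b b')) =
      K0_class (mat_dsum p p') (mat_dsum q q')" if "(a, b) \<in> K0_class p q" for a b
    by (rule UN_constant_eq[OF 1(2)]) (use 2 that in blast)
  show ?thesis
    unfolding K0_select by (rule UN_constant_eq[OF 1(1)]) (use 3 in blast)
qed

lemma K0_class_mem_carrier:
  assumes "p \<in> mat_projections" "q \<in> mat_projections"
  shows "K0_class p q \<in> carrier (K0 T)"
  unfolding K0_select K0_class_def using assms by (intro quotientI SigmaI)

lemma K0_carrierE:
  assumes "X \<in> carrier (K0 T)"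
  obtains p q where "X = K0_class p q" "p \<in> mat_projections" "q \<in> mat_projections"
proof -
  obtain x where "x \<in> mat_projections \<times> mat_projections" "X = K0_rel `` {x}"
    using assms unfolding K0_select by (rule quotientE)
  then show ?thesis using that[of "fst x" "snd x"] by (simp add: K0_class_def mem_Times_iff)
qed

lemma K0_mult_closed:
  assumes "X \<in> carrier (K0 T)" "Y \<in> carrier (K0 T)"
  shows "X \<otimes>\<^bsub>K0 T\<^esub> Y \<in> carrier (K0 T)"
  using assms
  by (elim K0_carrierE) (simp only: K0_mult_class K0_class_mem_carrier mat_dsum_projections)

lemma K0_pos_cone_subset: "pos_cone (K0 T) \<subseteq> carrier (K0 T)"
proof
  fix X assume "X \<in> pos_cone (K0 T)"
  then obtain p where "p \<in> mat_projections" "X = K0_class p (0\<^sub>m 0 0)"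
    unfolding K0_select by blast
  then show "X \<in> carrier (K0 T)" by (simp only: K0_class_mem_carrier zero_mat_projections)
qed

lemma K0_order_unit_closed: "order_unit (K0 T) \<in> carrier (K0 T)"
  unfolding K0_select(4) by (intro K0_class_mem_carrier one_mat_projections zero_mat_projections)

section \<open>The isomorphism of \<open>K0\<close> induced by a unital star-isomorphism\<close>

lemma unital_star_isomorphism_inv:
  assumes "unital_star_isomorphism \<phi>"
  shows "unital_star_isomorphism (inv_into UNIV \<phi>)"
proof -
  have b: "bij \<phi>" using assms by (simp add: unital_star_isomorphism_def)
  note f = bij_is_surj[OF b, THEN surj_f_inv_f] and g = bij_is_inj[OF b, THEN inv_f_f]
  have eqI: "inv_into UNIV \<phi> y = x" if "\<phi> x = y" for x y using g that by blast
  show ?thesis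
    unfolding unital_star_isomorphism_def
    using assms bij_imp_bij_inv[OF b]
    by (auto simp: unital_star_isomorphism_def f intro!: eqI)
qed

lemma unital_star_isomorphism_zero:
  assumes "unital_star_isomorphism \<phi>"
  shows "\<phi> 0 = 0"
proof -
  have "\<phi> (0 + 0) = \<phi> 0 + \<phi> 0" using assms unfolding unital_star_isomorphism_def by blast
  then show ?thesis by simp
qed

lemma unital_star_isomorphism_sum:
  assumes "unital_star_isomorphism \<phi>"
  shows "\<phi> (sum f S) = (\<Sum>i\<in>S. \<phi> (f i))"
  using assms unital_star_isomorphism_zero[OF assms]
  by (induction S rule: infinite_finite_induct) (auto simp: unital_star_isomorphism_def)

lemma map_mat_mult_iso:
  assumes "unital_star_isomorphism \<phi>" "A \<in> carrier_mat a b" "B \<in> carrier_mat b c"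
  shows "map_mat \<phi> (A * B) = map_mat \<phi> A * map_mat \<phi> B"
proof -
  have "\<phi> (x * y) = \<phi> x * \<phi> y" for x y using assms(1) by (simp add: unital_star_isomorphism_def)
  then show ?thesis using assms(2,3)
    by (intro eq_matI) (auto simp: scalar_prod_def unital_star_isomorphism_sum[OF assms(1)] intro!: sum.cong)
qed

lemma map_mat_star_iso:
  assumes "unital_star_isomorphism \<phi>"
  shows "map_mat \<phi> (mat_star A) = mat_star (map_mat \<phi> A)"
  using assms by (intro eq_matI) (auto simp: mat_star_def unital_star_isomorphism_def)

lemma map_mat_dsum_iso:
  assumes "unital_star_isomorphism \<phi>"
  shows "map_mat \<phi> (mat_dsum A B) = mat_dsum (map_mat \<phi> A) (map_mat \<phi> B)"
  using unital_star_isomorphism_zero[OF assms] by (intro eq_matI) (auto simp: mat_dsum_def)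

lemma map_mat_projections_iso:
  assumes "unital_star_isomorphism \<phi>" "p \<in> mat_projections"
  shows "map_mat \<phi> p \<in> mat_projections"
proof -
  note p = mat_projectionsD[OF assms(2)]
  show ?thesis
    by (rule mat_projectionsI[of _ "dim_row p"])
      (simp_all only: map_carrier_mat p(1) map_mat_mult_iso[OF assms(1) p(1) p(1), symmetric] p(2)
        map_mat_star_iso[OF assms(1), symmetric] p(3))
qed

lemma mvn_equiv_map_mat_iso:
  assumes iso: "unital_star_isomorphism \<phi>" and "mvn_equiv p q"
  shows "mvn_equiv (map_mat \<phi> p) (map_mat \<phi> q)"
proof -
  obtain v where v: "v \<in> carrier_mat (dim_row q) (dim_row p)" "mat_star v * v = p" "v * mat_star v = q"
    using assms(2) by (auto simp: mvn_equiv_def)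
  note c = mat_star_carrier[OF v(1)]
  show ?thesis
    by (rule mvn_equivI[of "map_mat \<phi> v"])
      (simp_all only: map_carrier_mat index_map_mat v map_mat_star_iso[OF iso, symmetric]
        map_mat_mult_iso[OF iso c v(1), symmetric] map_mat_mult_iso[OF iso v(1) c, symmetric])
qed

lemma K0_rel_map_mat_iso:
  assumes iso: "unital_star_isomorphism \<phi>" and rel: "((p, q), (p', q')) \<in> K0_rel"
  shows "((map_mat \<phi> p, map_mat \<phi> q), (map_mat \<phi> p', map_mat \<phi> q')) \<in> K0_rel"
proof -
  obtain r where "r \<in> mat_projections" "mvn_equiv (mat_dsum (mat_dsum p q') r) (mat_dsum (mat_dsum p' q) r)"
    using rel by (auto simp: K0_rel_def)
  then have "map_mat \<phi> r \<in> mat_projections"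
    "mvn_equiv (mat_dsum (mat_dsum (map_mat \<phi> p) (map_mat \<phi> q')) (map_mat \<phi> r))
      (mat_dsum (mat_dsum (map_mat \<phi> p') (map_mat \<phi> q)) (map_mat \<phi> r))"
    unfolding map_mat_dsum_iso[OF iso, symmetric]
    by (blast intro: map_mat_projections_iso[OF iso] mvn_equiv_map_mat_iso[OF iso])+
  then show ?thesis
    using rel map_mat_projections_iso[OF iso] unfolding K0_rel_def by blast
qed

text \<open>Classes are sets of pairs, so the induced map is the image under entrywise application
  of \<open>\<phi>\<close>. The point to check is that the image of a class is a full class; this
  uses the inverse of \<open>\<phi>\<close>.\<close>

lemma K0_iso_of_unital_star_isomorphism:
  fixes \<phi> :: "'a::unital_cstar_algebra \<Rightarrow> 'b::unital_cstar_algebra"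
  assumes iso: "unital_star_isomorphism \<phi>"
  shows "unit_ordered_iso (K0 TYPE('a)) (K0 TYPE('b))"
proof -
  let ?f = "map_mat \<phi>" and ?g = "map_mat (inv_into UNIV \<phi>)"
  have b: "bij \<phi>" using iso by (simp add: unital_star_isomorphism_def)
  note iso' = unital_star_isomorphism_inv[OF iso]
  have fg: "?f (?g A) = A" for A
    by (rule eq_matI) (auto simp: bij_is_surj[OF b, THEN surj_f_inv_f])
  have gf: "?g (?f A) = A" for A
    by (rule eq_matI) (auto simp: bij_is_inj[OF b, THEN inv_f_f])
  define h where "h = (image (map_prod ?f ?f) :: ('a mat \<times> 'a mat) set \<Rightarrow> _)"
  have inj: "inj (map_prod ?f ?f)"
    by (rule inj_on_inverseI[where g = "map_prod ?g ?g"]) (auto simp: gf)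
  have h_class: "h (K0_class p q) = K0_class (?f p) (?f q)" for p q
  proof (intro equalityI subsetI)
    fix x assume "x \<in> h (K0_class p q)"
    then show "x \<in> K0_class (?f p) (?f q)"
      by (auto simp: h_def K0_class_def K0_rel_map_mat_iso[OF iso])
  next
    fix x assume "x \<in> K0_class (?f p) (?f q)"
    then obtain a c where x: "x = (a, c)" "((?f p, ?f q), (a, c)) \<in> K0_rel"
      by (cases x) (auto simp: K0_class_def)
    then have "(?g a, ?g c) \<in> K0_class p q"
      using K0_rel_map_mat_iso[OF iso' x(2)] by (simp add: K0_class_def gf)
    then show "x \<in> h (K0_class p q)" unfolding h_def x
      by (intro image_eqI[of _ _ "(?g a, ?g c)"]) (auto simp: fg)
  qed
  note pf = map_mat_projections_iso[OF iso] and pg = map_mat_projections_iso[OF iso']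
  have img: "?f ` mat_projections = mat_projections"
  proof (intro equalityI subsetI)
    fix p :: "'b mat" assume "p \<in> mat_projections"
    then show "p \<in> ?f ` mat_projections" using pg by (intro image_eqI[of _ _ "?g p"]) (simp_all add: fg)
  qed (use pf in auto)
  have empty: "?f (0\<^sub>m 0 0) = 0\<^sub>m 0 0" by (rule eq_matI) auto
  have one: "?f (1\<^sub>m 1) = 1\<^sub>m 1"
    using iso by (intro eq_matI) (auto simp: unital_star_isomorphism_def)
  have "h ` carrier (K0 TYPE('a)) = carrier (K0 TYPE('b))"
  proof (intro equalityI subsetI)
    fix X assume "X \<in> h ` carrier (K0 TYPE('a))"
    then obtain p q where "X = h (K0_class p q)" "p \<in> mat_projections" "q \<in> mat_projections"
      by (auto elim: K0_carrierE)
    then show "X \<in> carrier (K0 TYPE('b))" by (simp only: h_class pf K0_class_mem_carrier)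
  next
    fix X assume "X \<in> carrier (K0 TYPE('b))"
    then obtain p q where X: "X = K0_class p q" "p \<in> mat_projections" "q \<in> mat_projections"
      by (rule K0_carrierE)
    then have "X = h (K0_class (?g p) (?g q))" by (simp add: h_class fg)
    moreover have "K0_class (?g p) (?g q) \<in> carrier (K0 TYPE('a))"
      using X pg by (simp only: K0_class_mem_carrier)
    ultimately show "X \<in> h ` carrier (K0 TYPE('a))" by (rule image_eqI)
  qed
  moreover have "inj_on h (carrier (K0 TYPE('a)))"
    unfolding h_def using inj by (auto simp: inj_on_def inj_image_eq_iff)
  ultimately have bij: "bij_betw h (carrier (K0 TYPE('a))) (carrier (K0 TYPE('b)))"
    by (simp add: bij_betw_def)
  have mult: "h (X \<otimes>\<^bsub>K0 TYPE('a)\<^esub> Y) = h X \<otimes>\<^bsub>K0 TYPE('b)\<^esub> h Y"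
    if "X \<in> carrier (K0 TYPE('a))" "Y \<in> carrier (K0 TYPE('a))" for X Y
    using that
    by (elim K0_carrierE) (simp only: K0_mult_class h_class map_mat_dsum_iso[OF iso] pf)
  have "h \<in> iso (K0 TYPE('a)) (K0 TYPE('b))"
    using bij mult by (auto simp: iso_def hom_def bij_betw_def)
  moreover have "h ` pos_cone (K0 TYPE('a)) = pos_cone (K0 TYPE('b))"
  proof -
    have "h ` pos_cone (K0 TYPE('a)) = (\<lambda>p. K0_class p (0\<^sub>m 0 0)) ` (?f ` mat_projections)"
      by (simp only: K0_select image_image h_class empty)
    then show ?thesis by (simp only: img K0_select)
  qed
  moreover have "h (order_unit (K0 TYPE('a))) = order_unit (K0 TYPE('b))"
    by (simp only: K0_select h_class empty one)
  ultimately show ?thesis unfolding unit_ordered_iso_def by blast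
qed

text \<open>The inverse of \<open>h\<close> is controlled only on the carrier. The three additional
  hypotheses keep products, cone and unit of \<open>G\<close> inside it, so no group axioms are
  required.\<close>

lemma unit_ordered_iso_sym:
  assumes iso: "unit_ordered_iso G H"
    and closed: "\<And>x y. x \<in> carrier G \<Longrightarrow> y \<in> carrier G \<Longrightarrow> x \<otimes>\<^bsub>G\<^esub> y \<in> carrier G"
    and cone: "pos_cone G \<subseteq> carrier G" and unit: "order_unit G \<in> carrier G"
  shows "unit_ordered_iso H G"
proof -
  obtain h where h: "h \<in> iso G H" "h ` pos_cone G = pos_cone H" "h (order_unit G) = order_unit H"
    using iso by (auto simp: unit_ordered_iso_def)
  let ?g = "inv_into (carrier G) h"
  have bij: "bij_betw h (carrier G) (carrier H)" using h by (simp add: iso_def)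
  have gh: "?g (h x) = x" if "x \<in> carrier G" for x
    using bij that by (simp add: bij_betw_def)
  have "?g (x \<otimes>\<^bsub>H\<^esub> y) = ?g x \<otimes>\<^bsub>G\<^esub> ?g y" if xy: "x \<in> carrier H" "y \<in> carrier H" for x y
  proof -
    obtain a b where ab: "a \<in> carrier G" "b \<in> carrier G" "x = h a" "y = h b"
      using xy unfolding bij_betw_imp_surj_on[OF bij, symmetric] by blast
    then have "x \<otimes>\<^bsub>H\<^esub> y = h (a \<otimes>\<^bsub>G\<^esub> b)" using h by (simp add: iso_def hom_def)
    then show ?thesis using ab gh closed by simp
  qed
  then have "?g \<in> iso H G"
    using bij_betw_inv_into[OF bij] by (auto simp: iso_def hom_def bij_betw_def)
  moreover have "?g ` pos_cone H = pos_cone G"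
    unfolding h(2)[symmetric] image_image using gh cone by force
  moreover have "?g (order_unit H) = order_unit G"
    unfolding h(3)[symmetric] using gh unit by simp
  ultimately show ?thesis unfolding unit_ordered_iso_def by blast
qed

lemma unit_ordered_iso_trans [trans]:
  assumes "unit_ordered_iso G H" "unit_ordered_iso H K"
  shows "unit_ordered_iso G K"
proof -
  obtain h where h: "h \<in> iso G H" "h ` pos_cone G = pos_cone H" "h (order_unit G) = order_unit H"
    using assms(1) by (auto simp: unit_ordered_iso_def)
  obtain k where k: "k \<in> iso H K" "k ` pos_cone H = pos_cone K" "k (order_unit H) = order_unit K"
    using assms(2) by (auto simp: unit_ordered_iso_def)
  have "k \<circ> h \<in> iso G K" by (rule iso_set_trans[OF h(1) k(1)])
  then show ?thesis
    unfolding unit_ordered_iso_def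
    by (intro bexI[of _ "k \<circ> h"]) (simp_all only: image_comp[symmetric] comp_apply h k)
qed

text \<open>This removes the C*-algebras from the problem: from here on only the dimension groups
  matter.\<close>

lemma dim_group_iso_of_unital_star_isomorphism:
  fixes \<phi> :: "'a::unital_cstar_algebra \<Rightarrow> 'b::unital_cstar_algebra"
  assumes "is_AF_of TYPE('a) N m" "is_AF_of TYPE('b) N' m'" "unital_star_isomorphism \<phi>"
  shows "unit_ordered_iso (dim_group N m) (dim_group N' m')"
proof -
  have A: "unit_ordered_iso (K0 TYPE('a)) (dim_group N m)"
    and B: "unit_ordered_iso (K0 TYPE('b)) (dim_group N' m')"
    using assms(1,2) by (simp_all only: is_AF_of_def)
  have "unit_ordered_iso (dim_group N m) (K0 TYPE('a))"
    by (rule unit_ordered_iso_sym[OF A K0_mult_closed K0_pos_cone_subset K0_order_unit_closed])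
  also have "unit_ordered_iso \<dots> (K0 TYPE('b))"
    by (rule K0_iso_of_unital_star_isomorphism[OF assms(3)])
  also note B
  finally show ?thesis .
qed

section \<open>Averaging recursions and matrices in standard form\<close>

lemma additive_set_contains_all_large:
  fixes T I :: "nat set"
  assumes "I \<subseteq> T" "0 \<in> T" and add: "\<And>x y. x \<in> T \<Longrightarrow> y \<in> T \<Longrightarrow> x + y \<in> T"
    and "Gcd I = 1"
  shows "\<exists>K. \<forall>k\<ge>K. k \<in> T"
proof -
  have mult: "n * x \<in> T" if "x \<in> T" for n x
    using that by (induction n) (auto intro: add \<open>0 \<in> T\<close>)
  define D where "D = {d. 0 < d \<and> (\<exists>x\<in>T. \<exists>y\<in>T. x = y + d)}"
  have ITD: "i \<in> D" if "i \<in> I" "i > 0" for i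
    using that \<open>I \<subseteq> T\<close> \<open>0 \<in> T\<close> unfolding D_def by force
  \<comment> \<open>The least positive difference of two elements divides all of \<open>I\<close>, hence is 1;
    from \<open>y, y + 1 \<in> T\<close> everything from \<open>y * y\<close> on is generated.\<close>
  have "\<exists>i\<in>I. i > 0"
  proof (rule ccontr)
    assume "\<not> ?thesis"
    then have "Gcd I = 0" by (intro Gcd_0_iff[THEN iffD2]) auto
    with assms show False by simp
  qed
  with ITD have ne: "\<exists>d. d \<in> D" by auto
  define d where "d = (LEAST d. d \<in> D)"
  have dD: "d \<in> D" unfolding d_def using ne by (rule LeastI_ex)
  then obtain x y where xy: "x \<in> T" "y \<in> T" "x = y + d" "d > 0" by (auto simp: D_def)
  have "d dvd i" if i: "i \<in> I" for i
  proof (rule ccontr)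
    assume "\<not> d dvd i"
    then have pos: "i mod d > 0" by (simp add: dvd_eq_mod_eq_0)
    have "i + (i div d) * y \<in> T" using mult[OF xy(2)] add i assms(1) by auto
    moreover have "i + (i div d) * y = (i div d) * x + i mod d"
      using xy(3) by (simp add: algebra_simps)
    ultimately have "i mod d \<in> D" unfolding D_def using pos mult[OF xy(1)] by auto
    then have "d \<le> i mod d" unfolding d_def by (rule Least_le)
    moreover have "i mod d < d" using xy(4) by simp
    ultimately show False by simp
  qed
  then have "d dvd Gcd I" by (rule Gcd_greatest)
  then have d1: "d = 1" using assms(4) by simp
  show ?thesis
  proof (intro exI allI impI)
    fix k assume k: "k \<ge> y * y + 1"
    show "k \<in> T"
    proof (cases "y = 0")
      case True
      then show ?thesis using mult[OF xy(1), of k] xy(3) d1 by simp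
    next
      case False
      \<comment> \<open>Here \<open>x = y + 1\<close>. For \<open>k\<close> beyond
        \<open>y * y\<close> the quotient by \<open>y\<close> is at least the remainder, so that
        many copies of \<open>y\<close> can be traded for copies of \<open>x\<close>, which absorb
        the remainder.\<close>
      have "y * y div y \<le> k div y" using k by (intro div_le_mono) auto
      moreover have "k mod y < y" using False by simp
      ultimately have "k mod y \<le> k div y" using nonzero_mult_div_cancel_right[OF False, of y] by linarith
      then obtain e where e: "k div y = k mod y + e" using le_Suc_ex by blast
      have "k = (k mod y + e) * y + k mod y" using div_mult_mod_eq[of k y] e by simp
      also have "\<dots> = e * y + (k mod y) * x" using xy(3) d1 by (simp add: algebra_simps)
      finally have "k = e * y + (k mod y) * x" .
      then show ?thesis using add mult xy by metis
    qed
  qed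
qed

text \<open>A discrete renewal theorem. The maximum over a window of length \<open>N\<close> does not increase and
  takes discrete values, so it stabilizes at some \<open>M\<close>; the value \<open>M\<close> at \<open>n\<close> forces it at \<open>n - i\<close>
  whenever \<open>c i \<noteq> 0\<close>, and since these \<open>i\<close> have greatest common divisor 1, it spreads to all
  large indices.\<close>

lemma averaging_sequence_eventually_const:
  fixes r c :: "nat \<Rightarrow> rat" and d :: nat
  assumes c: "\<And>i. c i \<ge> 0" and c1: "(\<Sum>i=1..N. c i) = 1"
    and gcd1: "Gcd {i \<in> {1..N}. c i \<noteq> 0} = 1"
    and rec: "\<And>n. r (n + N) = (\<Sum>i=1..N. c i * r (n + N - i))"
    and d: "d > 0" and int: "\<And>n. of_nat d * r n \<in> \<int>"
  shows "\<exists>n1 M. \<forall>n\<ge>n1. r n = M"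
proof -
  have N: "N > 0" using c1 by (cases N) auto
  define s where "s = (\<lambda>n. \<lfloor>of_nat d * r n\<rfloor>)"
  have s: "of_int (s n) = of_nat d * r n" for n
    using int[of n] by (simp add: s_def)
  have s_rec: "of_int (s (n + N)) = (\<Sum>i=1..N. c i * of_int (s (n + N - i)))" for n
    unfolding s rec[of n] sum_distrib_left by (intro sum.cong) auto
  have upper: "s (n + N) \<le> B" if "\<And>k. n \<le> k \<Longrightarrow> k < n + N \<Longrightarrow> s k \<le> B" for n B
  proof -
    have "of_int (s (n + N)) \<le> (\<Sum>i=1..N. c i * of_int B)"
      unfolding s_rec using that by (intro sum_mono mult_left_mono c) auto
    then show ?thesis unfolding sum_distrib_right[symmetric] c1 by simp
  qed
  have lower: "B \<le> s (n + N)" if "\<And>k. n \<le> k \<Longrightarrow> k < n + N \<Longrightarrow> B \<le> s k" for n B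
  proof -
    have "(\<Sum>i=1..N. c i * of_int B) \<le> of_int (s (n + N))"
      unfolding s_rec using that by (intro sum_mono mult_left_mono c) auto
    then show ?thesis unfolding sum_distrib_right[symmetric] c1 by simp
  qed
  define W where "W = (\<lambda>n. Max (s ` {n..<n+N}))"
  have sW: "s k \<le> W n" if "n \<le> k" "k < n + N" for n k
    unfolding W_def using that by (intro Max_ge) auto
  have W_in: "\<exists>k. n \<le> k \<and> k < n + N \<and> s k = W n" for n
  proof -
    have "W n \<in> s ` {n..<n+N}" unfolding W_def using N by (intro Max_in) auto
    then show ?thesis by auto
  qed
  have W_Suc: "W (Suc n) \<le> W n" for n
  proof -
    obtain k where k: "Suc n \<le> k" "k < Suc n + N" "s k = W (Suc n)" using W_in by blast
    show ?thesis
    proof (cases "k = n + N")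
      case True
      then show ?thesis using k upper[of n "W n"] sW by auto
    next
      case False
      then show ?thesis using k sW[of n k] by auto
    qed
  qed
  \<comment> \<open>The minimum of the first \<open>N\<close> values bounds the whole sequence from
    below. Hence the nonincreasing integer sequence \<open>W\<close> attains a least value, at
    \<open>n1\<close>, and is constant from there on.\<close>
  define B where "B = Min (s ` {..<N})"
  have B: "B \<le> s n" for n
  proof (induction n rule: less_induct)
    case (less n)
    show ?case
    proof (cases "n < N")
      case True
      then show ?thesis unfolding B_def by (intro Min_le) auto
    next
      case False
      then show ?thesis using lower[of "n - N" B] less by auto
    qed
  qed
  have WB: "B \<le> W n" for n using W_in[of n] B by metis
  obtain n1 where n1: "\<And>n. nat (W n1 - B) \<le> nat (W n - B)"
    using ex_has_least_nat[of "\<lambda>_. True" 0 "\<lambda>n. nat (W n - B)"] by blast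
  define M where "M = W n1"
  have WM: "W n = M" if "n \<ge> n1" for n
  proof -
    have "W n \<le> W n1" using that by (rule lift_Suc_antimono_le[of W, OF W_Suc])
    moreover have "W n1 \<le> W n" using n1[of n] WB[of n] by linarith
    ultimately show ?thesis by (simp add: M_def)
  qed
  have sM: "s n \<le> M" if "n \<ge> n1" for n
    using sW[of n n] WM[OF that] N by simp
  \<comment> \<open>\<open>T\<close> collects the lags along which the value \<open>M\<close>
    propagates backwards. The margin \<open>n1 + N + k\<close> keeps the \<open>N\<close>
    predecessors of \<open>n\<close> and of \<open>n - k\<close> in the range where \<open>M\<close>
    is an upper bound.\<close>
  define T where "T = {k. \<forall>n \<ge> n1 + N + k. s n = M \<longrightarrow> s (n - k) = M}"
  have IT: "i \<in> T" if i: "i \<in> {i \<in> {1..N}. c i \<noteq> 0}" for i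
  proof -
    have "s (n - i) = M" if n: "n \<ge> n1 + N + i" and sn: "s n = M" for n
    proof -
      \<comment> \<open>As the weights sum to 1, the weighted deficits from \<open>M\<close> add up
        to 0. They are nonnegative, so each vanishes, and \<open>c i \<noteq> 0\<close> forces
        deficit 0 at lag \<open>i\<close>.\<close>
      have "(\<Sum>j=1..N. c j * (of_int M - of_int (s (n - j)))) = 0"
        using s_rec[of "n - N"] n sn c1
        by (simp add: right_diff_distrib sum_subtractf flip: sum_distrib_right)
      then have "\<forall>j\<in>{1..N}. c j * (of_int M - of_int (s (n - j))) = 0"
        using sM n by (subst (asm) sum_nonneg_eq_0_iff) (auto intro!: mult_nonneg_nonneg c)
      then show ?thesis using i by force
    qed
    then show ?thesis by (auto simp: T_def)
  qed
  have "\<exists>K. \<forall>k\<ge>K. k \<in> T"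
  proof (rule additive_set_contains_all_large[OF _ _ _ gcd1])
    show "{i \<in> {1..N}. c i \<noteq> 0} \<subseteq> T" using IT by blast
    show "0 \<in> T" by (simp add: T_def)
    fix x y assume "x \<in> T" "y \<in> T"
    show "x + y \<in> T" unfolding T_def
    proof (intro CollectI allI impI)
      fix n assume n: "n1 + N + (x + y) \<le> n" "s n = M"
      then have "s (n - x) = M" using \<open>x \<in> T\<close> by (auto simp: T_def)
      moreover have "n1 + N + y \<le> n - x" using n by simp
      ultimately have "s (n - x - y) = M" using \<open>y \<in> T\<close> unfolding T_def by blast
      then show "s (n - (x + y)) = M" by simp
    qed
  qed
  then obtain K where K: "\<And>k. k \<ge> K \<Longrightarrow> k \<in> T" by blast
  have "s n = M" if n: "n \<ge> n1 + N" for n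
  proof -
    \<comment> \<open>Every window contains an index with value \<open>M\<close>. In the window
      starting at \<open>n + K\<close> this index lies at least \<open>K\<close> beyond
      \<open>n\<close>, so its distance to \<open>n\<close> is a lag in \<open>T\<close>.\<close>
    obtain k where k: "n + K \<le> k" "s k = M" using W_in[of "n + K"] WM[of "n + K"] n by auto
    then have "k - n \<in> T" using K by auto
    moreover have "n1 + N + (k - n) \<le> k" using k n by simp
    ultimately have "s (k - (k - n)) = M" using k unfolding T_def by blast
    then show ?thesis using k by simp
  qed
  then have "r n = of_int M / of_nat d" if "n \<ge> n1 + N" for n
    using s[of n] that d by (simp add: field_simps)
  then show ?thesis by blast
qed

section \<open>Standard-form matrices acting on rational vectors, and membership in the dimension
  group\<close>

lemma std_mat_carrier [simp]: "std_mat N m \<in> carrier_mat N N"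
  by (simp add: std_mat_def)

lemma dim_std_mat [simp]: "dim_row (std_mat N m) = N" "dim_col (std_mat N m) = N"
  by (simp_all add: std_mat_def)

lemma std_mat_mult_vec_carrier [simp]: "g \<in> carrier_vec N \<Longrightarrow> std_mat N m *\<^sub>v g \<in> carrier_vec N"
  by (rule mult_mat_vec_carrier[OF std_mat_carrier])

lemma std_mat_mult_vec_index:
  fixes v :: "'a::comm_ring_1 vec"
  assumes v: "v \<in> carrier_vec N" and i: "i < N"
  shows "(std_mat N m *\<^sub>v v) $ i =
    of_nat (m (Suc i)) * v $ 0 + (if Suc i < N then v $ Suc i else 0)"
proof -
  have "(std_mat N m *\<^sub>v v) $ i =
    (\<Sum>j = 0..<N. (if j = 0 then of_nat (m (i + 1)) else if j = i + 1 then 1 else 0) * v $ j)"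
    using v i by (auto simp: std_mat_def scalar_prod_def intro!: sum.cong)
  also have "\<dots> = (\<Sum>j = 0..<N. (if j = 0 then of_nat (m (i + 1)) * v $ j else 0) +
      (if j = i + 1 then v $ j else 0))"
    by (intro sum.cong) auto
  also have "\<dots> = of_nat (m (Suc i)) * v $ 0 + (if Suc i < N then v $ Suc i else 0)"
    unfolding sum.distrib using i by auto
  finally show ?thesis .
qed

text \<open>Powers of \<open>J\<close> are treated as iterates of the map on vectors, which suits
  induction on the exponent.\<close>

abbreviation std_iter :: "nat \<Rightarrow> (nat \<Rightarrow> nat) \<Rightarrow> nat \<Rightarrow> rat vec \<Rightarrow> rat vec" where
  "std_iter N m n \<equiv> (((*\<^sub>v) (std_mat N m)) ^^ n)"

lemma std_iter_carrier [simp]: "g \<in> carrier_vec N \<Longrightarrow> std_iter N m n g \<in> carrier_vec N"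
  by (induction n) auto

lemma pow_mat_vec_eq_funpow:
  fixes A :: "'a::comm_ring_1 mat"
  assumes A: "A \<in> carrier_mat N N" and "g \<in> carrier_vec N"
  shows "(A ^\<^sub>m n) *\<^sub>v g = (((*\<^sub>v) A) ^^ n) g"
  using assms(2)
proof (induction n arbitrary: g)
  case 0
  then show ?case using A by simp
next
  case (Suc n)
  have "(A ^\<^sub>m Suc n) *\<^sub>v g = (A ^\<^sub>m n) *\<^sub>v (A *\<^sub>v g)"
    using A Suc.prems by (simp add: assoc_mult_mat_vec[OF pow_carrier_mat[OF A] A])
  also have "\<dots> = (((*\<^sub>v) A) ^^ n) (A *\<^sub>v g)"
    using A Suc.prems by (intro Suc.IH) auto
  finally show ?case by (simp add: funpow_swap1)
qed

lemma std_iter_add_vec: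
  "g \<in> carrier_vec N \<Longrightarrow> g' \<in> carrier_vec N \<Longrightarrow>
    std_iter N m n (g + g') = std_iter N m n g + std_iter N m n g'"
  by (induction n) (auto simp: mult_add_distrib_mat_vec[OF std_mat_carrier])

lemma std_iter_smult:
  "g \<in> carrier_vec N \<Longrightarrow> std_iter N m n (k \<cdot>\<^sub>v g) = k \<cdot>\<^sub>v std_iter N m n g"
  by (induction n) (auto simp: mult_mat_vec[OF std_mat_carrier])

lemma std_mat_vec_int_lattice:
  "g \<in> int_lattice N \<Longrightarrow> std_mat N m *\<^sub>v g \<in> int_lattice N"
  by (auto simp: int_lattice_def std_mat_mult_vec_index simp del: index_mult_mat_vec
      intro!: Ints_add Ints_mult mult_mat_vec_carrier[OF std_mat_carrier])

lemma std_iter_int_lattice: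
  "g \<in> int_lattice N \<Longrightarrow> std_iter N m n g \<in> int_lattice N"
  by (induction n) (auto simp: std_mat_vec_int_lattice)

text \<open>The kernel is trivial: the last row gives \<open>m N * v $ 0 = 0\<close>, hence
  \<open>v $ 0 = 0\<close>, and then row \<open>k\<close> gives
  \<open>v $ Suc k = 0\<close>.\<close>

lemma std_mat_inverse:
  assumes "standard_form N m"
  obtains K :: "rat mat" where "mat_inverse (std_mat N m) = Some K" "K \<in> carrier_mat N N"
    "std_mat N m * K = 1\<^sub>m N" "K * std_mat N m = 1\<^sub>m N"
proof -
  let ?J = "std_mat N m :: rat mat"
  have N: "N > 0" "m N > 0" using assms by (auto simp: standard_form_def)
  have "v = 0\<^sub>v N" if v: "v \<in> carrier_vec N" and 0: "?J *\<^sub>v v = 0\<^sub>v N" for v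
  proof -
    have row: "of_nat (m (Suc i)) * v $ 0 + (if Suc i < N then v $ Suc i else 0) = 0" if "i < N" for i
      using std_mat_mult_vec_index[OF v that, of m] 0 that by simp
    have v0: "v $ 0 = 0" using row[of "N - 1"] N by simp
    have "v $ i = 0" if "i < N" for i
    proof (cases i)
      case (Suc k)
      then show ?thesis using row[of k] v0 that by simp
    qed (simp add: v0)
    then show ?thesis using v by (intro eq_vecI) auto
  qed
  then have "det ?J \<noteq> 0" using det_0_iff_vec_prod_zero[OF std_mat_carrier] by blast
  then have "?J \<in> Units (ring_mat TYPE(rat) N ())"
    by (rule det_non_zero_imp_unit[OF std_mat_carrier])
  then have "mat_inverse ?J \<noteq> None" using mat_inverse(1)[OF std_mat_carrier[of N m], where b = "()"] by blast
  then obtain K where "mat_inverse ?J = Some K" by blast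
  with mat_inverse(2)[OF std_mat_carrier this] that show ?thesis by blast
qed

text \<open>Trades the inverse matrix for an integrality condition on a forward iterate; all later
  arguments about the dimension group use this form.\<close>

lemma image_mat_powi_neg_iff:
  assumes "standard_form N m"
  shows "g \<in> (\<lambda>z. mat_powi (std_mat N m) (- int n) *\<^sub>v z) ` int_lattice N \<longleftrightarrow>
    g \<in> carrier_vec N \<and> std_iter N m n g \<in> int_lattice N"
proof -
  let ?J = "std_mat N m :: rat mat"
  obtain K where K: "mat_inverse ?J = Some K" "K \<in> carrier_mat N N"
    "?J * K = 1\<^sub>m N" "K * ?J = 1\<^sub>m N" using std_mat_inverse[OF assms] by blast
  have powi: "mat_powi ?J (- int n) = K ^\<^sub>m n"
    using K by (cases "n = 0") (auto simp: mat_powi_def)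
  let ?K = "\<lambda>n. ((*\<^sub>v) K) ^^ n"
  have Kc [simp]: "?K n g \<in> carrier_vec N" if "g \<in> carrier_vec N" for g n
    using that K(2) by (induction n) auto
  have JK: "?J *\<^sub>v (K *\<^sub>v g) = g" if "g \<in> carrier_vec N" for g
    using that assoc_mult_mat_vec[OF std_mat_carrier K(2) that] K(3)
    by (metis one_mult_mat_vec)
  have KJ: "K *\<^sub>v (?J *\<^sub>v g) = g" if "g \<in> carrier_vec N" for g
    using that assoc_mult_mat_vec[OF K(2) std_mat_carrier that] K(4)
    by (metis one_mult_mat_vec)
  have 1: "std_iter N m n (?K n g) = g" if "g \<in> carrier_vec N" for g n
    using that
  proof (induction n)
    case (Suc n)
    have "std_iter N m (Suc n) (?K (Suc n) g) = std_iter N m n (?J *\<^sub>v (K *\<^sub>v ?K n g))"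
      by (simp add: funpow_swap1)
    then show ?case using Suc JK by simp
  qed simp
  have 2: "?K n (std_iter N m n g) = g" if "g \<in> carrier_vec N" for g n
    using that
  proof (induction n)
    case (Suc n)
    have "?K (Suc n) (std_iter N m (Suc n) g) = ?K n (K *\<^sub>v (?J *\<^sub>v std_iter N m n g))"
      by (simp add: funpow_swap1)
    then show ?case using Suc KJ by simp
  qed simp
  have L: "z \<in> carrier_vec N" if "z \<in> int_lattice N" for z using that by (simp add: int_lattice_def)
  have img: "mat_powi ?J (- int n) *\<^sub>v z = ?K n z" if "z \<in> int_lattice N" for z
    unfolding powi using pow_mat_vec_eq_funpow[OF K(2) L[OF that]] .
  show ?thesis
  proof
    assume "g \<in> (\<lambda>z. mat_powi ?J (- int n) *\<^sub>v z) ` int_lattice N"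
    then obtain z where "z \<in> int_lattice N" "g = ?K n z" using img by auto
    then show "g \<in> carrier_vec N \<and> std_iter N m n g \<in> int_lattice N"
      using 1 L by auto
  next
    assume g: "g \<in> carrier_vec N \<and> std_iter N m n g \<in> int_lattice N"
    then show "g \<in> (\<lambda>z. mat_powi ?J (- int n) *\<^sub>v z) ` int_lattice N"
      using 2[of g n] img by (intro image_eqI[of _ _ "std_iter N m n g"]) auto
  qed
qed

lemma mem_dim_group_set_iff:
  assumes "standard_form N m"
  shows "g \<in> dim_group_set (std_mat N m) \<longleftrightarrow>
    g \<in> carrier_vec N \<and> (\<exists>n. std_iter N m n g \<in> int_lattice N)"
  unfolding dim_group_set_def using image_mat_powi_neg_iff[OF assms] by auto

lemma int_lattice_add: "g \<in> int_lattice N \<Longrightarrow> g' \<in> int_lattice N \<Longrightarrow> g + g' \<in> int_lattice N"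
  by (auto simp: int_lattice_def)

lemma int_lattice_smult: "k \<in> \<int> \<Longrightarrow> g \<in> int_lattice N \<Longrightarrow> k \<cdot>\<^sub>v g \<in> int_lattice N"
  by (auto simp: int_lattice_def)

lemma dim_group_set_add:
  assumes "standard_form N m" "g \<in> dim_group_set (std_mat N m)" "g' \<in> dim_group_set (std_mat N m)"
  shows "g + g' \<in> dim_group_set (std_mat N m)"
proof -
  obtain n k where nk: "g \<in> carrier_vec N" "std_iter N m n g \<in> int_lattice N"
    "g' \<in> carrier_vec N" "std_iter N m k g' \<in> int_lattice N"
    using assms by (auto simp: mem_dim_group_set_iff)
  have "std_iter N m (k + n) g \<in> int_lattice N" "std_iter N m (n + k) g' \<in> int_lattice N"
    using nk by (simp_all add: funpow_add std_iter_int_lattice)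
  then have "std_iter N m (n + k) (g + g') \<in> int_lattice N"
    using nk by (auto simp: std_iter_add_vec add.commute int_lattice_add)
  then show ?thesis using assms(1) nk by (auto simp: mem_dim_group_set_iff)
qed

lemma dim_group_set_smult:
  assumes "standard_form N m" "g \<in> dim_group_set (std_mat N m)" "k \<in> \<int>"
  shows "k \<cdot>\<^sub>v g \<in> dim_group_set (std_mat N m)"
  using assms by (auto simp: mem_dim_group_set_iff std_iter_smult intro: int_lattice_smult)

section \<open>Integral Perron-Frobenius eigenvalues\<close>

text \<open>The functional \<open>\<langle>\<alpha> | g\<rangle>\<close> for an integral eigenvalue \<open>l\<close>.\<close>

definition tau :: "nat \<Rightarrow> nat \<Rightarrow> rat vec \<Rightarrow> rat" where
  "tau N l g = (\<Sum>i<N. g $ i / of_nat l ^ i)"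

text \<open>\<open>eig_coeff m l i\<close> is the entry \<open>v (i + 1)\<close> of the right eigenvector.\<close>

fun eig_coeff :: "(nat \<Rightarrow> nat) \<Rightarrow> nat \<Rightarrow> nat \<Rightarrow> int" where
  "eig_coeff m l 0 = 1"
| "eig_coeff m l (Suc i) = int l * eig_coeff m l i - int (m (Suc i))"

definition eig_vec :: "nat \<Rightarrow> (nat \<Rightarrow> nat) \<Rightarrow> nat \<Rightarrow> rat vec" where
  "eig_vec N m l = vec N (\<lambda>i. of_int (eig_coeff m l i))"

lemma eig_vec_carrier [simp]: "eig_vec N m l \<in> carrier_vec N"
  by (simp add: eig_vec_def)

lemma eig_vec_int_lattice: "eig_vec N m l \<in> int_lattice N"
  by (simp add: eig_vec_def int_lattice_def)

text \<open>The Perron-Frobenius equation over the naturals, arranged so that no subtraction of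
  terms occurs.\<close>

definition char_root :: "nat \<Rightarrow> (nat \<Rightarrow> nat) \<Rightarrow> nat \<Rightarrow> bool" where
  "char_root N m l \<longleftrightarrow> 0 < l \<and> l ^ N = (\<Sum>i=1..N. m i * l ^ (N - i))"

text \<open>The recursion is the Horner scheme for the characteristic polynomial; its
  \<open>N\<close>-th stage is the full polynomial at \<open>l\<close>.\<close>

lemma eig_coeff_eq: "eig_coeff m l n = int l ^ n - (\<Sum>i=1..n. int (m i) * int l ^ (n - i))"
proof (induction n)
  case (Suc n)
  have "(\<Sum>i=1..n. int (m i) * int l ^ (Suc n - i)) = int l * (\<Sum>i=1..n. int (m i) * int l ^ (n - i))"
    unfolding sum_distrib_left by (intro sum.cong) (auto simp: Suc_diff_le)
  then show ?case unfolding eig_coeff.simps Suc.IH by (simp add: right_diff_distrib)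
qed simp

lemma eig_coeff_last:
  assumes "char_root N m l"
  shows "eig_coeff m l N = 0"
proof -
  have "int (l ^ N) = int (\<Sum>i=1..N. m i * l ^ (N - i))" using assms by (simp add: char_root_def)
  then show ?thesis by (simp add: eig_coeff_eq)
qed

text \<open>In the last row the missing entry is replaced by 0, which agrees with
  \<open>eig_coeff m l N = 0\<close>. Stated over the integers, the equation serves both the
  rational and the real eigenvector.\<close>

lemma eig_coeff_row:
  assumes "char_root N m l" "i < N"
  shows "int (m (Suc i)) + (if Suc i < N then eig_coeff m l (Suc i) else 0) = int l * eig_coeff m l i"
proof (cases "Suc i < N")
  case False
  then have "Suc i = N" using assms(2) by simp
  then have "eig_coeff m l (Suc i) = 0" using eig_coeff_last[OF assms(1)] by simp
  then show ?thesis using False by simp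
qed simp

lemma std_mat_eig_vec:
  assumes "char_root N m l"
  shows "std_mat N m *\<^sub>v eig_vec N m l = of_nat l \<cdot>\<^sub>v eig_vec N m l"
proof (rule eq_vecI)
  fix i assume "i < dim_vec (of_nat l \<cdot>\<^sub>v eig_vec N m l)"
  then have i: "i < N" by (simp add: eig_vec_def)
  have "(std_mat N m *\<^sub>v eig_vec N m l) $ i =
    of_int (int (m (Suc i)) + (if Suc i < N then eig_coeff m l (Suc i) else 0))"
    unfolding std_mat_mult_vec_index[OF eig_vec_carrier i] using i by (simp add: eig_vec_def)
  also have "\<dots> = (of_nat l \<cdot>\<^sub>v eig_vec N m l) $ i"
    unfolding eig_coeff_row[OF assms i] using i by (simp add: eig_vec_def)
  finally show "(std_mat N m *\<^sub>v eig_vec N m l) $ i = (of_nat l \<cdot>\<^sub>v eig_vec N m l) $ i" .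
qed (simp add: eig_vec_def)

text \<open>This is the characteristic equation divided by \<open>l ^ N\<close>; it makes the
  weights a probability distribution.\<close>

lemma char_root_sum_weights:
  assumes "char_root N m l"
  shows "(\<Sum>i=1..N. of_nat (m i) / of_nat l ^ i) = (1::rat)"
proof -
  have l: "(of_nat l::rat) \<noteq> 0" using assms by (simp add: char_root_def)
  have "(of_nat (l ^ N)::rat) = of_nat (\<Sum>i=1..N. m i * l ^ (N - i))"
    using assms by (simp add: char_root_def)
  also have "\<dots> = (\<Sum>i=1..N. of_nat l ^ N * (of_nat (m i) / of_nat l ^ i))"
    unfolding of_nat_sum of_nat_mult of_nat_power
    using l by (intro sum.cong) (auto simp: power_diff field_simps)
  also have "\<dots> = of_nat l ^ N * (\<Sum>i=1..N. of_nat (m i) / of_nat l ^ i)"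
    by (simp add: sum_distrib_left)
  finally show ?thesis using l by simp
qed

text \<open>The left eigenvector equation. The first column contributes \<open>l * g $ 0\<close>
  because the weights sum to 1; the superdiagonal shifts the remaining terms by one power of
  \<open>l\<close>.\<close>

lemma tau_std_mat:
  assumes "char_root N m l" and g: "g \<in> carrier_vec N"
  shows "tau N l (std_mat N m *\<^sub>v g) = of_nat l * tau N l g"
proof (cases N)
  case 0
  then show ?thesis by (simp add: tau_def)
next
  case (Suc K)
  have l: "(of_nat l::rat) \<noteq> 0" using assms by (simp add: char_root_def)
  have "(\<Sum>i<N. of_nat (m (Suc i)) / of_nat l ^ i) =
      of_nat l * (\<Sum>i<N. of_nat (m (Suc i)) / (of_nat l ^ Suc i ::rat))"
    unfolding sum_distrib_left using l by (intro sum.cong) auto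
  also have "(\<Sum>i<N. of_nat (m (Suc i)) / (of_nat l ^ Suc i ::rat)) =
      (\<Sum>i=1..N. of_nat (m i) / of_nat l ^ i)"
    by (rule sum.reindex_bij_witness[of _ "\<lambda>i. i - 1" Suc]) auto
  finally have 1: "(\<Sum>i<N. of_nat (m (Suc i)) / of_nat l ^ i) = (of_nat l::rat)"
    using char_root_sum_weights[OF assms(1)] by simp
  have "tau N l (std_mat N m *\<^sub>v g) = (\<Sum>i<N. of_nat (m (Suc i)) / of_nat l ^ i * g $ 0 +
      (if Suc i < N then g $ Suc i / of_nat l ^ i else 0))"
    unfolding tau_def
    by (intro sum.cong) (auto simp: std_mat_mult_vec_index[OF g] add_divide_distrib
        simp del: index_mult_mat_vec)
  also have "\<dots> = of_nat l * g $ 0 + (\<Sum>i<N. if Suc i < N then g $ Suc i / of_nat l ^ i else 0)"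
    unfolding sum.distrib sum_distrib_right[symmetric] 1 ..
  also have "(\<Sum>i<N. if Suc i < N then g $ Suc i / of_nat l ^ i else 0) =
      (\<Sum>i<K. of_nat l * (g $ Suc i / of_nat l ^ Suc i))"
    unfolding Suc using l by simp
  finally show ?thesis
    unfolding tau_def Suc sum.lessThan_Suc_shift
    by (simp add: sum_distrib_left distrib_left)
qed

lemma tau_std_iter:
  assumes "char_root N m l" and "g \<in> carrier_vec N"
  shows "tau N l (std_iter N m n g) = of_nat l ^ n * tau N l g"
  using assms by (induction n) (auto simp: tau_std_mat)

lemma tau_smult: "g \<in> carrier_vec N \<Longrightarrow> tau N l (k \<cdot>\<^sub>v g) = k * tau N l g"
  by (auto simp: tau_def sum_distrib_left intro!: sum.cong)

lemma tau_add:
  "g \<in> carrier_vec N \<Longrightarrow> g' \<in> carrier_vec N \<Longrightarrow> tau N l (g + g') = tau N l g + tau N l g'"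
  by (auto simp: tau_def add_divide_distrib simp flip: sum.distrib intro!: sum.cong)

lemma tau_unit_vec: "N > 0 \<Longrightarrow> tau N l (unit_vec N 0) = 1"
  by (cases N) (auto simp: tau_def sum.lessThan_Suc_shift intro!: sum.neutral simp del: sum.lessThan_Suc)

text \<open>The first entries \<open>r n\<close> of \<open>l\<^sup>-\<^sup>n J\<^sup>n w\<close> satisfy
  \<open>r (n + N) = (\<Sum>i=1..N. (m i / l\<^sup>i) * r (n + N - i))\<close> with weights summing to 1. They take values
  in \<open>l\<^sup>-\<^sup>a \<int>\<close>, hence become constant, and then \<open>l\<^sup>-\<^sup>n J\<^sup>n w\<close> is a multiple of the
  eigenvector.\<close>

lemma int_scaled_orbit_component:
  assumes sf: "standard_form N m" and root: "char_root N m l"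
    and w: "w \<in> carrier_vec N" and a: "a > 0"
    and int: "\<And>n. inverse (of_nat l ^ (a * n)) \<cdot>\<^sub>v std_iter N m (a * n) w \<in> int_lattice N"
  shows "\<exists>M\<in>\<int>. tau N l w = M * tau N l (eig_vec N m l)"
proof -
  have N: "N > 0" using sf by (simp add: standard_form_def)
  define L where "L = (of_nat l :: rat)"
  have L: "L > 0" using root by (simp add: L_def char_root_def)
  define x where "x = (\<lambda>n i. std_iter N m n w $ i / L ^ n)"
  have step: "L * x (Suc n) i = of_nat (m (Suc i)) * x n 0 + (if Suc i < N then x n (Suc i) else 0)"
    if "i < N" for n i
  proof -
    have "L * x (Suc n) i = (std_mat N m *\<^sub>v std_iter N m n w) $ i / L ^ n"
      using L by (simp add: x_def del: index_mult_mat_vec)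
    then show ?thesis
      unfolding std_mat_mult_vec_index[OF std_iter_carrier[OF w] that]
      by (simp add: x_def add_divide_distrib)
  qed
  \<comment> \<open>Unrolling \<open>step\<close> through \<open>j\<close> rows leaves one remainder
    term, in component \<open>j\<close> and \<open>j\<close> time steps back. It disappears at
    \<open>j = N\<close>.\<close>
  have rec_aux: "x (n + N) 0 = (\<Sum>i=1..j. of_nat (m i) / L ^ i * x (n + N - i) 0) +
      (if j < N then x (n + N - j) j / L ^ j else 0)" if "j \<le> N" for n j
    using that
  proof (induction j)
    case 0
    then show ?case using N by simp
  next
    case (Suc j)
    have "L * x (n + N - j) j = of_nat (m (Suc j)) * x (n + N - Suc j) 0 +
        (if Suc j < N then x (n + N - Suc j) (Suc j) else 0)"
      using step[of j "n + N - Suc j"] Suc.prems by (simp add: Suc_diff_Suc)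
    then have "x (n + N - j) j / L ^ j = of_nat (m (Suc j)) / L ^ Suc j * x (n + N - Suc j) 0 +
        (if Suc j < N then x (n + N - Suc j) (Suc j) / L ^ Suc j else 0)"
      using L by (auto simp: field_simps)
    then show ?case using Suc by auto
  qed
  have rec: "x (n + N) 0 = (\<Sum>i=1..N. of_nat (m i) / L ^ i * x (n + N - i) 0)" for n
    using rec_aux[of N n] by simp
  have int0: "x (a * n) i \<in> \<int>" if "i < N" for n i
  proof -
    have "(inverse (L ^ (a * n)) \<cdot>\<^sub>v std_iter N m (a * n) w) $ i \<in> \<int>"
      using int[of n] that unfolding int_lattice_def L_def by blast
    then show ?thesis using that carrier_vecD[OF std_iter_carrier[OF w]]
      by (simp add: x_def divide_inverse mult.commute)
  qed
  \<comment> \<open>From a multiple of \<open>a\<close>, where the scaled orbit is integral, each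
    further step costs at most one factor \<open>L\<close> in the denominator.\<close>
  have int_e: "L ^ e * x (a * q + e) i \<in> \<int>" if "i < N" for e q i
    using that
  proof (induction e arbitrary: i)
    case 0
    then show ?case using int0 by simp
  next
    case (Suc e)
    have "L ^ Suc e * x (a * q + Suc e) i = L ^ e * (L * x (Suc (a * q + e)) i)" by simp
    also have "\<dots> = of_nat (m (Suc i)) * (L ^ e * x (a * q + e) 0) +
        (if Suc i < N then L ^ e * x (a * q + e) (Suc i) else 0)"
      unfolding step[OF Suc.prems] by (auto simp: algebra_simps)
    also have "\<dots> \<in> \<int>" using Suc.IH[OF N] Suc.IH[of "Suc i"]
      by (auto intro!: Ints_add Ints_mult[OF Ints_of_nat])
    finally show ?case .
  qed
  have int_a: "of_nat (l ^ a) * x n 0 \<in> \<int>" for n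
  proof -
    \<comment> \<open>The number of steps since the last multiple of \<open>a\<close> is below
      \<open>a\<close>, so \<open>l ^ a\<close> is a common denominator for all
      \<open>n\<close>.\<close>
    have "L ^ (n mod a) * x n 0 \<in> \<int>" using int_e[OF N, of "n mod a" "n div a"] by simp
    then have "L ^ (a - n mod a) * (L ^ (n mod a) * x n 0) \<in> \<int>"
      by (rule Ints_mult[rotated]) (simp add: L_def)
    moreover have "L ^ (a - n mod a) * L ^ (n mod a) = L ^ a"
      using a by (simp flip: power_add)
    ultimately show ?thesis by (simp add: L_def flip: mult.assoc)
  qed
  have "\<exists>n1 M. \<forall>n\<ge>n1. x n 0 = M"
  proof (rule averaging_sequence_eventually_const[where c = "\<lambda>i. of_nat (m i) / L ^ i" and N = N])
    show "0 \<le> of_nat (m i) / L ^ i" for i using L by simp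
    show "(\<Sum>i=1..N. of_nat (m i) / L ^ i) = 1"
      using char_root_sum_weights[OF root] by (simp add: L_def)
    show "Gcd {i \<in> {1..N}. of_nat (m i) / L ^ i \<noteq> 0} = 1"
      using sf L by (simp add: standard_form_def)
    show "x (n + N) 0 = (\<Sum>i = 1..N. of_nat (m i) / L ^ i * x (n + N - i) 0)" for n by (rule rec)
    show "of_nat (l ^ a) * x n 0 \<in> \<int>" for n by (rule int_a)
    show "l ^ a > 0" using root by (simp add: char_root_def)
  qed
  then obtain n1 M where M: "\<And>n. n \<ge> n1 \<Longrightarrow> x n 0 = M" by blast
  \<comment> \<open>The index \<open>a * n1\<close> is both late enough for the limit value and a
    multiple of \<open>a\<close>, so the limit is an integer.\<close>
  have "n1 \<le> a * n1" using a by simp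
  then have "M \<in> \<int>" using int0[OF N, of n1] M by simp
  \<comment> \<open>With constant first entries, \<open>step\<close> determines entry
    \<open>Suc i\<close> from entry \<open>i\<close> one time step later, by the recursion that
    defines \<open>eig_coeff\<close>.\<close>
  have xM: "x n i = M * of_int (eig_coeff m l i)" if "i < N" "n \<ge> n1" for n i
    using that
  proof (induction i arbitrary: n)
    case 0
    then show ?case using M by simp
  next
    case (Suc i)
    have "L * x (Suc n) i = of_nat (m (Suc i)) * x n 0 + x n (Suc i)"
      using step[of i n] Suc.prems by simp
    then show ?case using Suc.IH[of "Suc n"] Suc.prems M[of n] by (simp add: L_def algebra_simps)
  qed
  \<comment> \<open>The functional is invariant under the scaled iteration, so it may be evaluated
    at time \<open>n1\<close>.\<close>
  have "tau N l w = tau N l (std_iter N m n1 w) / L ^ n1"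
    using tau_std_iter[OF root w] L by (simp add: L_def)
  also have "\<dots> = (\<Sum>i<N. x n1 i / L ^ i)"
    unfolding tau_def sum_divide_distrib x_def by (intro sum.cong) (auto simp: L_def field_simps)
  also have "\<dots> = (\<Sum>i<N. M * (eig_vec N m l $ i / of_nat l ^ i))"
    using xM by (intro sum.cong) (auto simp: eig_vec_def L_def)
  also have "\<dots> = M * tau N l (eig_vec N m l)" by (simp add: tau_def sum_distrib_left)
  finally show ?thesis using \<open>M \<in> \<int>\<close> by blast
qed

text \<open>In effect \<open>m N\<close> times the inverse of \<open>J\<close> is integral: the last
  row makes \<open>m N * g $ 0\<close> an integer, and each other row then yields
  \<open>m N * g $ Suc k\<close>.\<close>

lemma smult_int_lattice_of_std_mat:
  assumes sf: "standard_form N m" and g: "g \<in> carrier_vec N"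
    and Jg: "std_mat N m *\<^sub>v g \<in> int_lattice N"
  shows "of_nat (m N) \<cdot>\<^sub>v g \<in> int_lattice N"
proof -
  have N: "N > 0" using sf by (simp add: standard_form_def)
  have row: "of_nat (m (Suc i)) * g $ 0 + (if Suc i < N then g $ Suc i else 0) \<in> \<int>" if "i < N" for i
    using Jg that unfolding int_lattice_def std_mat_mult_vec_index[OF g that, of m, symmetric] by blast
  have 0: "of_nat (m N) * g $ 0 \<in> \<int>" using row[of "N - 1"] N by simp
  have "of_nat (m N) * g $ i \<in> \<int>" if "i < N" for i
  proof (cases i)
    case (Suc k)
    have "of_nat (m N) * g $ i = of_nat (m N) * (of_nat (m (Suc k)) * g $ 0 + g $ Suc k) -
        of_nat (m (Suc k)) * (of_nat (m N) * g $ 0)"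
      by (simp add: Suc algebra_simps)
    also have "\<dots> \<in> \<int>"
      by (rule Ints_diff[OF Ints_mult[OF Ints_of_nat] Ints_mult[OF Ints_of_nat]])
        (use row[of k] 0 Suc that in auto)
    finally show ?thesis .
  qed (simp add: 0)
  then show ?thesis using g by (auto simp: int_lattice_def)
qed

lemma smult_int_lattice_of_std_iter:
  assumes sf: "standard_form N m"
  shows "g \<in> carrier_vec N \<Longrightarrow> std_iter N m k g \<in> int_lattice N \<Longrightarrow>
    of_nat (m N) ^ k \<cdot>\<^sub>v g \<in> int_lattice N"
proof (induction k arbitrary: g)
  case 0
  then show ?case by (simp add: one_smult_vec)
next
  case (Suc k)
  have "of_nat (m N) ^ k \<cdot>\<^sub>v (std_mat N m *\<^sub>v g) \<in> int_lattice N"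
    using Suc by (intro Suc.IH) (auto simp: funpow_swap1)
  then have "std_mat N m *\<^sub>v (of_nat (m N) ^ k \<cdot>\<^sub>v g) \<in> int_lattice N"
    using Suc.prems by (simp add: mult_mat_vec[OF std_mat_carrier])
  then have "of_nat (m N) \<cdot>\<^sub>v (of_nat (m N) ^ k \<cdot>\<^sub>v g) \<in> int_lattice N"
    using Suc.prems by (intro smult_int_lattice_of_std_mat[OF sf]) auto
  then show ?case by (simp add: smult_smult_assoc)
qed

text \<open>Modulo \<open>l\<close> only the term \<open>m N\<close> of the characteristic equation
  survives. Thus division by \<open>l\<close> can be undone by multiplication by a multiple of
  \<open>m N\<close>.\<close>

lemma char_root_dvd:
  assumes "char_root N m l" "N > 0"
  shows "l dvd m N"
proof -
  have "{1..N} = insert N {1..<N}" using assms(2) by auto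
  then have "l ^ N = m N + (\<Sum>i=1..<N. m i * l ^ (N - i))"
    using assms(1) by (simp add: char_root_def)
  moreover have "l dvd l ^ N" using assms(2) by (intro dvd_power) auto
  moreover have "l dvd (\<Sum>i=1..<N. m i * l ^ (N - i))"
    by (intro dvd_sum dvd_mult dvd_power) auto
  ultimately show ?thesis by (metis dvd_add_left_iff)
qed

text \<open>The eigenvalue is a root of a monic integral polynomial, hence an algebraic integer, and
  a rational algebraic integer is an integer.\<close>

lemma pf_eigenvalue_rational:
  assumes sf: "standard_form N m" and rat: "pf_eigenvalue N m \<in> \<rat>"
  obtains l where "char_root N m l" "pf_eigenvalue N m = real l"
proof -
  let ?x = "pf_eigenvalue N m"
  define p where "p = monom 1 N - (\<Sum>i=1..N. monom (real (m i)) (N - i))"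
  have coeff: "coeff p k = (if k = N then 1 else 0) - (\<Sum>i=1..N. if N - i = k then real (m i) else 0)" for k
    by (simp add: p_def coeff_sum)
  have "coeff p N = 1" unfolding coeff by (auto intro!: sum.neutral)
  moreover have "degree p \<le> N"
    unfolding p_def by (intro degree_diff_le degree_sum_le order.trans[OF degree_monom_le]) auto
  ultimately have "degree p = N" by (intro antisym le_degree) auto
  then have "algebraic_int ?x"
  proof (intro algebraic_int.intros[of p])
    show "lead_coeff p = 1" using \<open>degree p = N\<close> \<open>coeff p N = 1\<close> by simp
    show "\<forall>i. coeff p i \<in> \<int>" unfolding coeff by (auto intro!: Ints_diff Ints_sum)
    show "poly p ?x = 0" using pf_eigenvalue(2)[OF sf] by (simp add: p_def poly_sum poly_monom)
  qed
  then have "?x \<in> \<int>" using rat by (rule rational_algebraic_int_is_int)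
  then obtain z where z: "?x = of_int z" by (elim Ints_cases)
  with pf_eigenvalue(1)[OF sf] have "z > 0" by simp
  define l where "l = nat z"
  have l: "?x = real l" "l > 0" using z \<open>z > 0\<close> by (auto simp: l_def)
  have "real (l ^ N) = real (\<Sum>i=1..N. m i * l ^ (N - i))"
    using pf_eigenvalue(2)[OF sf] l by simp
  then have "char_root N m l" using l unfolding char_root_def by (simp only: of_nat_eq_iff)
  with l that show ?thesis by blast
qed

section \<open>Real Perron-Frobenius data expressed through rational vectors\<close>

lemma pf_left_scalar_prod:
  assumes "pf_eigenvalue N m = real l" "g \<in> carrier_vec N"
  shows "scalar_prod (pf_left N m) (map_vec of_rat g) = of_rat (tau N l g)"
  using assms by (auto simp: pf_left_def scalar_prod_def tau_def of_rat_sum of_rat_divide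
      of_rat_power field_simps lessThan_atLeast0 intro!: sum.cong)

text \<open>Uniqueness of the normalized eigenvector identifies the described vector with the
  explicit integral one.\<close>

lemma pf_right_eq:
  assumes sf: "standard_form N m" and root: "char_root N m l" and l: "pf_eigenvalue N m = real l"
  shows "pf_right N m = map_vec of_rat (eig_vec N m l)"
proof -
  let ?v = "map_vec of_rat (eig_vec N m l) :: real vec"
  have N: "N > 0" using sf by (simp add: standard_form_def)
  have c: "?v \<in> carrier_vec N" by simp
  have "std_mat N m *\<^sub>v ?v = pf_eigenvalue N m \<cdot>\<^sub>v ?v"
  proof (rule eq_vecI)
    fix i assume "i < dim_vec (pf_eigenvalue N m \<cdot>\<^sub>v ?v)"
    then have i: "i < N" by (simp add: eig_vec_def)
    have "(std_mat N m *\<^sub>v ?v) $ i =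
      of_int (int (m (Suc i)) + (if Suc i < N then eig_coeff m l (Suc i) else 0))"
      unfolding std_mat_mult_vec_index[OF c i] using i by (simp add: eig_vec_def of_rat_diff of_rat_mult)
    also have "\<dots> = (pf_eigenvalue N m \<cdot>\<^sub>v ?v) $ i"
      unfolding eig_coeff_row[OF root i] using i by (simp add: eig_vec_def l)
    finally show "(std_mat N m *\<^sub>v ?v) $ i = (pf_eigenvalue N m \<cdot>\<^sub>v ?v) $ i" .
  qed (simp add: eig_vec_def)
  moreover have "?v $ 0 = 1" using N by (simp add: eig_vec_def)
  ultimately show ?thesis
    unfolding pf_right_def using c by (intro the1_equality[OF pf_right_unique[OF sf]]) auto
qed

section \<open>Isomorphisms of dimension groups\<close>

text \<open>Additivity is available only on \<open>G\<close>, and vectors cancel only within a fixed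
  dimension. Zero and negative multiples are therefore settled entrywise.\<close>

lemma additive_int_smult:
  fixes h :: "rat vec \<Rightarrow> rat vec"
  assumes G: "G \<subseteq> carrier_vec N" "\<And>g k. g \<in> G \<Longrightarrow> of_int k \<cdot>\<^sub>v g \<in> G"
    and h: "\<And>g. g \<in> G \<Longrightarrow> h g \<in> carrier_vec N'"
    and add: "\<And>g g'. g \<in> G \<Longrightarrow> g' \<in> G \<Longrightarrow> h (g + g') = h g + h g'"
    and g: "g \<in> G"
  shows "h (of_int k \<cdot>\<^sub>v g) = of_int k \<cdot>\<^sub>v h g"
proof -
  have gc: "g \<in> carrier_vec N" using G g by blast
  have zero: "h (of_int 0 \<cdot>\<^sub>v g) = of_int 0 \<cdot>\<^sub>v h g"
  proof -
    have "of_int 0 \<cdot>\<^sub>v g + g = g" using gc by auto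
    then have "h (of_int 0 \<cdot>\<^sub>v g) + h g = h g" using add[OF G(2)[OF g, of 0] g] by simp
    moreover have c: "h (of_int 0 \<cdot>\<^sub>v g) \<in> carrier_vec N'" "h g \<in> carrier_vec N'"
      using h G(2) g by blast+
    ultimately have "h (of_int 0 \<cdot>\<^sub>v g) $ i + h g $ i = h g $ i" if "i < N'" for i
      using that index_add_vec(1)[of i "h g" "h (of_int 0 \<cdot>\<^sub>v g)"] by simp
    then show ?thesis using c by (intro eq_vecI) auto
  qed
  have pred: "h (of_int (k + 1) \<cdot>\<^sub>v g) = h (of_int k \<cdot>\<^sub>v g) + h g" for k
    using add[OF G(2)[OF g] g, of k] gc by (simp add: add_smult_distrib_vec one_smult_vec)
  show ?thesis
  proof (induction k rule: int_induct[where k = 0])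
    case base
    then show ?case by (rule zero)
  next
    case (step1 k)
    then show ?case unfolding pred using h[OF g] by (simp add: add_smult_distrib_vec one_smult_vec)
  next
    case (step2 k)
    have c: "h (of_int (k - 1) \<cdot>\<^sub>v g) \<in> carrier_vec N'" using h G(2) g by blast
    have eq: "h (of_int (k - 1) \<cdot>\<^sub>v g) + h g = of_int k \<cdot>\<^sub>v h g"
      using pred[of "k - 1"] step2 by simp
    show ?case
    proof (rule eq_vecI)
      fix i assume "i < dim_vec (of_int (k - 1) \<cdot>\<^sub>v h g)"
      then have i: "i < N'" using h[OF g] by simp
      have "(h (of_int (k - 1) \<cdot>\<^sub>v g) + h g) $ i = (of_int k \<cdot>\<^sub>v h g) $ i" using eq by simp
      then show "h (of_int (k - 1) \<cdot>\<^sub>v g) $ i = (of_int (k - 1) \<cdot>\<^sub>v h g) $ i"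
        using i c h[OF g] by (simp add: algebra_simps)
    qed (use c h[OF g] in auto)
  qed
qed

text \<open>Each eigenvalue enters twice: as a natural root, for exact rational arithmetic, and as
  the value of \<open>pf_eigenvalue\<close>, on which the positive cones depend.\<close>

locale dim_group_iso =
  fixes N :: nat and m m' :: "nat \<Rightarrow> nat" and l l' :: nat and h :: "rat vec \<Rightarrow> rat vec"
  assumes sf: "standard_form N m" and sf': "standard_form N m'"
    and root: "char_root N m l" and root': "char_root N m' l'"
    and pf: "pf_eigenvalue N m = real l" and pf': "pf_eigenvalue N m' = real l'"
    and iso: "h \<in> iso (dim_group N m) (dim_group N m')"
    and cone: "h ` pos_cone (dim_group N m) = pos_cone (dim_group N m')"
    and unit: "h (unit_vec N 0) = unit_vec N 0"
begin

abbreviation "G \<equiv> dim_group_set (std_mat N m)"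
abbreviation "G' \<equiv> dim_group_set (std_mat N m')"
abbreviation "v \<equiv> eig_vec N m l"

lemma N_pos: "N > 0"
  using sf by (simp add: standard_form_def)

lemma G_carrier: "g \<in> G \<Longrightarrow> g \<in> carrier_vec N" "g \<in> G' \<Longrightarrow> g \<in> carrier_vec N"
  by (simp_all add: mem_dim_group_set_iff sf sf')

lemma h_bij: "bij_betw h G G'"
  using iso by (simp add: iso_def dim_group_def)

lemma h_mem: "g \<in> G \<Longrightarrow> h g \<in> G'"
  using h_bij by (auto simp: bij_betw_def)

lemma h_add: "g \<in> G \<Longrightarrow> g' \<in> G \<Longrightarrow> h (g + g') = h g + h g'"
  using iso by (simp add: iso_def hom_def dim_group_def)

lemma h_smult: "g \<in> G \<Longrightarrow> h (of_int k \<cdot>\<^sub>v g) = of_int k \<cdot>\<^sub>v h g"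
  by (rule additive_int_smult[of G N _ N])
    (auto intro: G_carrier h_mem h_add dim_group_set_smult[OF sf])

text \<open>If \<open>h g\<close> were positive, it would come from an element of the cone, which is
  \<open>g\<close> by injectivity. An element of the cone with vanishing functional is 0, and so is
  its image.\<close>

lemma not_pos_of_tau_zero:
  assumes g: "g \<in> G" and 0: "tau N l g = 0"
  shows "\<not> tau N l' (h g) > 0"
proof
  assume pos: "tau N l' (h g) > 0"
  have "h g \<in> pos_cone (dim_group N m')"
    using h_mem[OF g] pos pf_left_scalar_prod[OF pf' G_carrier(2)[OF h_mem[OF g]]]
    by (simp add: dim_group_def)
  then obtain y where y: "y \<in> pos_cone (dim_group N m)" "h y = h g" using cone by force
  then have "y = g" using h_bij g by (auto simp: bij_betw_def inj_on_def dim_group_def)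
  with y 0 pf_left_scalar_prod[OF pf G_carrier(1)[OF g]] have "g = 0\<^sub>v N"
    by (auto simp: dim_group_def)
  then have "0 \<cdot>\<^sub>v g = g" by auto
  then have "h g = 0 \<cdot>\<^sub>v h g" using h_smult[OF g, of 0] by simp
  then have "tau N l' (h g) = 0" using tau_smult[OF G_carrier(2)[OF h_mem[OF g]], of l' 0] by simp
  with pos show False by simp
qed

text \<open>The order sees only the vanishing of the functional; \<open>\<langle>\<alpha> | g\<rangle> = a / b\<close> is recovered by looking
  at \<open>b g - a [1]\<close>.\<close>

lemma tau_h:
  assumes g: "g \<in> G"
  shows "tau N l' (h g) = tau N l g"
proof -
  obtain a b where ab: "quotient_of (tau N l g) = (a, b)" by (cases "quotient_of (tau N l g)")
  have b: "b > 0" and eq: "tau N l g = of_int a / of_int b"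
    using quotient_of_denom_pos[OF ab] quotient_of_div[OF ab] by auto
  let ?e = "unit_vec N 0 :: rat vec"
  have "?e \<in> int_lattice N" by (auto simp: int_lattice_def)
  then have e: "?e \<in> G" by (auto simp: mem_dim_group_set_iff[OF sf] intro!: exI[of _ 0])
  define x where "x = of_int b \<cdot>\<^sub>v g + of_int (- a) \<cdot>\<^sub>v ?e"
  have bg: "of_int b \<cdot>\<^sub>v g \<in> G" and ae: "of_int (- a) \<cdot>\<^sub>v ?e \<in> G"
    using g e by (auto intro!: dim_group_set_smult[OF sf] simp del: of_int_minus)
  have x: "x \<in> G" unfolding x_def by (rule dim_group_set_add[OF sf bg ae])
  have tx: "tau N l x = 0"
    using b G_carrier(1)[OF g] N_pos
    by (simp add: x_def tau_add[where N = N] tau_smult[where N = N] tau_unit_vec eq)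
  have hx: "h x = of_int b \<cdot>\<^sub>v h g + of_int (- a) \<cdot>\<^sub>v ?e"
    unfolding x_def h_add[OF bg ae] h_smult[OF g] h_smult[OF e] unit ..
  have thx: "tau N l' (h x) = of_int b * tau N l' (h g) - of_int a"
    using G_carrier(2)[OF h_mem[OF g]] N_pos
    by (simp add: hx tau_add[where N = N] tau_smult[where N = N] tau_unit_vec)
  \<comment> \<open>The previous lemma excludes only positive values; applied to \<open>- x\<close>
    it excludes negative ones as well.\<close>
  have "\<not> tau N l' (h (of_int (- 1) \<cdot>\<^sub>v x)) > 0"
    using x tx G_carrier(1)[OF x]
    by (intro not_pos_of_tau_zero dim_group_set_smult[OF sf]) (auto simp: tau_smult[where N = N])
  then have "\<not> tau N l' (h x) < 0"
    unfolding h_smult[OF x] tau_smult[OF G_carrier(2)[OF h_mem[OF x]]] by simp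
  then have "tau N l' (h x) = 0" using not_pos_of_tau_zero[OF x tx] by simp
  then have "of_int b * tau N l' (h g) = of_int b * tau N l g" using thx eq b by simp
  then show ?thesis using b by simp
qed

text \<open>Since \<open>J\<close> multiplies \<open>v\<close> by \<open>l\<close>, its
  \<open>i\<close>-th power carries the scaled vector back to the integral vector
  \<open>v\<close>.\<close>

lemma v_scaled_mem: "inverse (of_nat l ^ i) \<cdot>\<^sub>v v \<in> G"
proof -
  have l: "(of_nat l :: rat) \<noteq> 0" using root by (simp add: char_root_def)
  have "std_iter N m i v = of_nat l ^ i \<cdot>\<^sub>v v"
    by (induction i) (auto simp: mult_mat_vec[OF std_mat_carrier] std_mat_eig_vec[OF root]
        smult_smult_assoc one_smult_vec mult.commute)
  then have "std_iter N m i (inverse (of_nat l ^ i) \<cdot>\<^sub>v v) = v"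
    using l by (simp add: std_iter_smult smult_smult_assoc one_smult_vec)
  then show ?thesis using eig_vec_int_lattice[of N m l]
    by (auto simp: mem_dim_group_set_iff[OF sf] intro!: exI[of _ i])
qed

lemma tau_eig_vec_component:
  fixes p q :: rat
  assumes l1: "l > 1" and l1': "l' > 1" and q: "q \<noteq> 0"
    and deg: "m_deg_le (lcm (m N) (m' N)) (std_mat N m') (of_rat (p / q))"
    and pow: "real l' powr of_rat p = real l powr of_rat q"
  shows "\<exists>M\<in>\<int>. \<exists>c. of_nat l' ^ c * tau N l v = M * tau N l' (eig_vec N m' l')"
proof -
  let ?k = "lcm (m N) (m' N)"
  have lpos: "(of_nat l :: rat) \<noteq> 0" using l1 by simp
  obtain a b where ab: "quotient_of (p / q) = (a, b)" by (cases "quotient_of (p / q)")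
  have b: "b > 0" and eq: "p / q = of_int a / of_int b"
    using quotient_of_denom_pos[OF ab] quotient_of_div[OF ab] by auto
  have t: "(of_rat (p / q) :: real) = of_int a / of_int b"
    by (simp add: eq of_rat_divide)
  have lnl: "ln (real l) > 0" "ln (real l') > 0" using l1 l1' by simp_all
  \<comment> \<open>Logarithms give \<open>p / q = ln l / ln l'\<close>, a positive number since
    \<open>l\<close> and \<open>l'\<close> exceed 1. So numerator \<open>a\<close> and denominator
    \<open>b\<close> are positive, and the power identity becomes one between naturals.\<close>
  have "of_rat p * ln (real l') = of_rat q * ln (real l)"
    using arg_cong[OF pow, of ln] l1 l1' by (simp add: ln_powr)
  then have "(of_rat (p / q) :: real) * ln (real l') = ln (real l)"
    using q by (simp add: of_rat_divide field_simps)
  then have lneq: "of_int a * ln (real l') = of_int b * ln (real l)"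
    unfolding t using b by (simp add: field_simps)
  have "of_int b * ln (real l) > 0" using b lnl by simp
  then have "of_int a * ln (real l') > 0" using lneq by simp
  then have a: "a > 0" using lnl by (simp add: zero_less_mult_iff)
  define A B where "A = nat a" and "B = nat b"
  have AB: "a = int A" "b = int B" "A > 0" "B > 0" using a b by (auto simp: A_def B_def)
  have "ln (real (l' ^ A)) = ln (real (l ^ B))"
    using lneq l1 l1' by (simp add: AB ln_realpow)
  then have "real (l' ^ A) = real (l ^ B)"
    using l1 l1' by (subst (asm) ln_inj_iff) auto
  then have lAB: "l' ^ A = l ^ B" by (simp only: of_nat_eq_iff)
  have v: "v \<in> G" using v_scaled_mem[of 0] by (simp add: one_smult_vec)
  have hvc: "h v \<in> carrier_vec N" by (rule G_carrier(2)[OF h_mem[OF v]])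
  \<comment> \<open>The exponent \<open>k\<close> only measures the denominators of
    \<open>h v\<close>; it is distinct from the modulus \<open>?k\<close>.\<close>
  obtain k where k: "std_iter N m' k (h v) \<in> int_lattice N"
    using h_mem[OF v] by (auto simp: mem_dim_group_set_iff[OF sf'])
  obtain d where d: "?k = m' N * d" using dvd_lcm2[of "m' N" "m N"] by (elim dvdE)
  obtain d' where d': "?k = l * d'"
    using char_root_dvd[OF root N_pos] dvd_trans[OF _ dvd_lcm1] by (metis dvdE)
  have hk: "of_nat ?k ^ k \<cdot>\<^sub>v h v \<in> int_lattice N"
  proof -
    have "of_nat d ^ k \<cdot>\<^sub>v (of_nat (m' N) ^ k \<cdot>\<^sub>v h v) \<in> int_lattice N"
      by (intro int_lattice_smult smult_int_lattice_of_std_iter[OF sf' hvc k]) auto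
    then show ?thesis by (simp add: d smult_smult_assoc power_mult_distrib mult.commute)
  qed
  obtain n0 where n0: "\<And>g i. g \<in> G' \<Longrightarrow> of_nat ?k ^ i \<cdot>\<^sub>v g \<in> int_lattice N \<Longrightarrow>
     g \<in> (\<lambda>z. mat_powi (std_mat N m') (- \<lfloor>real i * of_rat (p / q)\<rfloor> - int n0) *\<^sub>v z) ` int_lattice N"
    using deg unfolding m_deg_le_def dim_std_mat by blast
  \<comment> \<open>The degree bound will be used at \<open>i = B * n + k\<close>. As
    \<open>B * (p / q) = A\<close>, it permits the exponent \<open>A * n + c\<close> with
    \<open>c\<close> independent of \<open>n\<close>.\<close>
  define c where "c = nat \<lfloor>real k * of_rat (p / q)\<rfloor> + n0"
  define w where "w = std_iter N m' c (h v)"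
  have wc: "w \<in> carrier_vec N" by (simp add: w_def hvc)
  have "inverse (of_nat l' ^ (A * n)) \<cdot>\<^sub>v std_iter N m' (A * n) w \<in> int_lattice N" for n
  proof -
    define g where "g = h (inverse (of_nat l ^ (B * n)) \<cdot>\<^sub>v v)"
    have gG: "g \<in> G'" unfolding g_def by (intro h_mem v_scaled_mem)
    have gc: "g \<in> carrier_vec N" by (rule G_carrier(2)[OF gG])
    have "of_int (int l ^ (B * n)) \<cdot>\<^sub>v (inverse (of_nat l ^ (B * n)) \<cdot>\<^sub>v v) = v"
      using lpos by (simp add: smult_smult_assoc one_smult_vec)
    then have hv: "h v = of_nat l ^ (B * n) \<cdot>\<^sub>v g"
      using h_smult[OF v_scaled_mem[of "B * n"], of "int l ^ (B * n)"] by (simp add: g_def)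
    \<comment> \<open>The cofactor \<open>d'\<close> completes \<open>l ^ (B * n)\<close> to
      \<open>?k ^ (B * n)\<close>, so that \<open>?k ^ (B * n + k)\<close> clears the denominators
      of \<open>g\<close>.\<close>
    have "of_nat d' ^ (B * n) \<cdot>\<^sub>v (of_nat ?k ^ k \<cdot>\<^sub>v h v) \<in> int_lattice N"
      by (intro int_lattice_smult hk) auto
    also have "of_nat d' ^ (B * n) \<cdot>\<^sub>v (of_nat ?k ^ k \<cdot>\<^sub>v h v) =
        (of_nat d' ^ (B * n) * of_nat ?k ^ k * of_nat l ^ (B * n)) \<cdot>\<^sub>v g"
      by (simp add: hv smult_smult_assoc mult.assoc)
    also have "(of_nat d' ^ (B * n) * of_nat ?k ^ k * of_nat l ^ (B * n) :: rat) =
        of_nat ?k ^ (B * n + k)"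
      by (simp only: power_add) (simp add: d' power_mult_distrib mult_ac)
    finally have "g \<in> (\<lambda>z. mat_powi (std_mat N m')
        (- \<lfloor>real (B * n + k) * of_rat (p / q)\<rfloor> - int n0) *\<^sub>v z) ` int_lattice N"
      by (rule n0[OF gG])
    moreover have "- \<lfloor>real (B * n + k) * of_rat (p / q)\<rfloor> - int n0 = - int (A * n + c)"
    proof -
      have "real (B * n + k) * of_rat (p / q) = of_int (int (A * n)) + real k * of_rat (p / q)"
        unfolding t using AB by (simp add: field_simps)
      then have "\<lfloor>real (B * n + k) * of_rat (p / q)\<rfloor> = int (A * n) + \<lfloor>real k * of_rat (p / q)\<rfloor>"
        by (simp only: int_add_floor)
      \<comment> \<open>Nonnegativity ensures that \<open>nat\<close> in the definition of
        \<open>c\<close> does not truncate.\<close>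
      moreover have "\<lfloor>real k * of_rat (p / q)\<rfloor> \<ge> 0" unfolding t using a b by simp
      ultimately show ?thesis by (simp add: c_def)
    qed
    ultimately have "g \<in> (\<lambda>z. mat_powi (std_mat N m') (- int (A * n + c)) *\<^sub>v z) ` int_lattice N"
      by (simp only:)
    then have "std_iter N m' (A * n + c) g \<in> int_lattice N"
      using image_mat_powi_neg_iff[OF sf'] by blast
    moreover have "inverse (of_nat l' ^ (A * n)) \<cdot>\<^sub>v std_iter N m' (A * n) w = std_iter N m' (A * n + c) g"
    proof -
      \<comment> \<open>By \<open>l' ^ A = l ^ B\<close>, the factor between \<open>h v\<close> and
        \<open>g\<close> is exactly the power of \<open>l'\<close> by which the orbit of
        \<open>w\<close> is scaled.\<close>
      have "(of_nat l ^ (B * n) :: rat) = of_nat l' ^ (A * n)"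
        using lAB by (simp add: power_mult flip: of_nat_power)
      then have "std_iter N m' (A * n) w = of_nat l' ^ (A * n) \<cdot>\<^sub>v std_iter N m' (A * n + c) g"
        using gc by (simp add: w_def hv std_iter_smult funpow_add)
      then show ?thesis using l1' by (simp add: smult_smult_assoc one_smult_vec)
    qed
    ultimately show ?thesis by simp
  qed
  then obtain M where M: "M \<in> \<int>" "tau N l' w = M * tau N l' (eig_vec N m' l')"
    using int_scaled_orbit_component[OF sf' root' wc AB(3)] by blast
  moreover have "tau N l' w = of_nat l' ^ c * tau N l v"
    unfolding w_def tau_std_iter[OF root' hvc] tau_h[OF v] ..
  ultimately show ?thesis by metis
qed

end

text \<open>With \<open>l = 1\<close> the entries sum to 1, so \<open>m N\<close> is the only
  nonzero one and the gcd condition reads \<open>N = 1\<close>. This settles the case in which the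
  logarithm of the eigenvalue vanishes.\<close>

lemma char_root_one:
  assumes sf: "standard_form N m" and root: "char_root N m 1"
  shows "N = 1"
proof -
  have N: "N > 0" "m N > 0" using sf by (auto simp: standard_form_def)
  have "{1..N} = insert N {1..<N}" using N by auto
  then have "1 = m N + (\<Sum>i=1..<N. m i)" using root by (simp add: char_root_def)
  then have "(\<Sum>i=1..<N. m i) = 0" using N by linarith
  then have "\<forall>i\<in>{1..<N}. m i = 0" by simp
  then have "{i \<in> {1..N}. m i \<noteq> 0} = {N}" using N by (auto simp: le_less)
  then show ?thesis using sf by (simp add: standard_form_def)
qed

lemma int_adjoin_inverse_power: "of_int M * (1 / x) ^ c \<in> int_adjoin (1 / x)"
proof -
  have "of_int M * (1 / x) ^ c = poly (map_poly of_int (monom M c)) (1 / x)"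
    by (simp add: map_poly_monom poly_monom)
  then show ?thesis unfolding int_adjoin_def by blast
qed

lemma ratio_in_int_adjoin:
  fixes p q :: rat
  assumes sf: "standard_form N m" and sf': "standard_form N m'"
    and rat: "pf_eigenvalue N m \<in> \<rat>" and rat': "pf_eigenvalue N m' \<in> \<rat>"
    and q: "q \<noteq> 0"
    and deg: "m_deg_le (lcm (m N) (m' N)) (std_mat N m') (of_rat (p / q))"
    and pow: "pf_eigenvalue N m' powr of_rat p = pf_eigenvalue N m powr of_rat q"
    and iso: "unit_ordered_iso (dim_group N m) (dim_group N m')"
  shows "scalar_prod (pf_left N m) (pf_right N m) / scalar_prod (pf_left N m') (pf_right N m')
         \<in> int_adjoin (1 / pf_eigenvalue N m')"
proof -
  obtain l where l: "char_root N m l" "pf_eigenvalue N m = real l"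
    using pf_eigenvalue_rational[OF sf rat] .
  obtain l' where l': "char_root N m' l'" "pf_eigenvalue N m' = real l'"
    using pf_eigenvalue_rational[OF sf' rat'] .
  obtain h where h: "h \<in> iso (dim_group N m) (dim_group N m')"
    "h ` pos_cone (dim_group N m) = pos_cone (dim_group N m')" "h (unit_vec N 0) = unit_vec N 0"
    using iso by (auto simp: unit_ordered_iso_def dim_group_def)
  interpret dim_group_iso N m m' l l' h
    by unfold_locales (use sf sf' l l' h in auto)
  have prod: "scalar_prod (pf_left N m) (pf_right N m) = of_rat (tau N l (eig_vec N m l))"
    "scalar_prod (pf_left N m') (pf_right N m') = of_rat (tau N l' (eig_vec N m' l'))"
    unfolding pf_right_eq[OF sf l] pf_right_eq[OF sf' l']
    by (simp_all add: pf_left_scalar_prod l(2) l'(2))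
  have pos: "l > 0" "l' > 0" using l l' by (auto simp: char_root_def)
  show ?thesis
  proof (cases "l = 1")
    case True
    \<comment> \<open>In dimension 1 both eigenvectors are the vector with single entry 1, so both
      pairings equal 1.\<close>
    then have "N = 1" using char_root_one[OF sf] l by simp
    then have "scalar_prod (pf_left N m) (pf_right N m) / scalar_prod (pf_left N m') (pf_right N m') = 1"
      unfolding prod by (simp add: tau_def eig_vec_def)
    then show ?thesis using int_adjoin_inverse_power[of 1 _ 0] by simp
  next
    case False
    then have l1: "l > 1" using pos by simp
    \<comment> \<open>If \<open>l'\<close> were 1, the power identity would make \<open>l\<close> to
      a nonzero exponent equal to 1, contrary to \<open>l > 1\<close>.\<close>
    have l1': "l' > 1"
    proof (rule ccontr)
      assume "\<not> ?thesis"
      then have "l' = 1" using pos by simp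
      then have "real l powr of_rat q = 1" using pow l l' by simp
      then show False using l1 q by (simp add: powr_def)
    qed
    obtain M' c where M': "M' \<in> \<int>" "of_nat l' ^ c * tau N l (eig_vec N m l) = M' * tau N l' (eig_vec N m' l')"
      using tau_eig_vec_component[OF l1 l1' q deg] pow l l' by auto
    obtain M where M: "M' = of_int M" using M'(1) by (elim Ints_cases)
    show ?thesis
    proof (cases "tau N l' (eig_vec N m' l') = 0")
      \<comment> \<open>Here the quotient is 0 by the convention for division by zero, and 0 lies in
        the ring.\<close>
      case True
      then show ?thesis unfolding prod using int_adjoin_inverse_power[of 0] by simp
    next
      case False
      then have "tau N l (eig_vec N m l) / tau N l' (eig_vec N m' l') = of_int M * (1 / of_nat l') ^ c"
        using M' l1' by (simp add: M field_simps)
      from arg_cong[OF this, of "of_rat :: rat \<Rightarrow> real"] show ?thesis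
        unfolding prod l'(2) using int_adjoin_inverse_power[of M "real l'" c]
        by (simp add: of_rat_divide of_rat_mult of_rat_power)
    qed
  qed
qed

theorem theorem11p10:
  fixes N :: nat and m m' :: "nat \<Rightarrow> nat" and p q :: rat
    and \<phi> :: "'a::unital_cstar_algebra \<Rightarrow> 'b::unital_cstar_algebra"
  assumes "standard_form N m" and "standard_form N m'"
    and "prime_factors (m N) = prime_factors (m' N)"
    and "pf_eigenvalue N m \<in> \<rat>" and "pf_eigenvalue N m' \<in> \<rat>"
    and "q \<noteq> 0"
    and "m_deg_le (lcm (m N) (m' N)) (std_mat N m') (of_rat (p / q))"
    and "pf_eigenvalue N m' powr of_rat p = pf_eigenvalue N m powr of_rat q"
    and "is_AF_of TYPE('a) N m" and "is_AF_of TYPE('b) N m'"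
    and "unital_star_isomorphism \<phi>"
  shows "scalar_prod (pf_left N m) (pf_right N m) / scalar_prod (pf_left N m') (pf_right N m')
         \<in> int_adjoin (1 / pf_eigenvalue N m')"
  using assms by (intro ratio_in_int_adjoin dim_group_iso_of_unital_star_isomorphism)

end
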